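(* For every $r>0$, each of the $(4^4)$, D$(3,4,6,4)$ and D$(3,6,3,6)$ lattices has a finite subgraph which is not $(r,t)$-total-threshold-colorable for any $t\ge0$.
   Context: An edge labeling of a graph $G=(V,E)$ is a map $l:E\to\{N,F\}$. A threshold-coloring of $G$ with respect to $l$ is a map $c:V\to\mathbb{Z}$ with an integer $t\ge0$ such that for every edge $(u,v)$, $|c(u)-c(v)|\le t$ iff $l(u,v)=N$; if $m,M$ are the minimum and maximum of $c$, any integer $r>M-m$ is a range, and $c$ is an $(r,t)$-threshold-coloring. $G$ is $(r,t)$-total-threshold-colorable if for every edge labeling there is an $(r,t)$-threshold-coloring with respect to it. $(4^4)$ is the square grid lattice. D$(A)$ denotes the planar dual graph of the Archimedean lattice $A$: $(3,4,6,4)$ is the rhombitrihexagonal tiling (each vertex in a triangle, square, hexagon, square) and its dual D$(3,4,6,4)$ is the deltoidal trihexagonal tiling; $(3,6,3,6)$ is the trihexagonal (kagome) tiling and its dual D$(3,6,3,6)$ is the rhombille tiling. *)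

theory Defs
  imports "HOL-Analysis.Analysis"
begin

record 'a ugraph =
  verts :: "'a set"
  edges :: "'a set set"

definition simple_graph :: "'a ugraph \<Rightarrow> bool" where
  "simple_graph G \<longleftrightarrow> (\<forall>e\<in>edges G. e \<subseteq> verts G \<and> card e = 2)"

text \<open>Graphs are taken to be nonempty, so that the minimum and maximum of a coloring exist.\<close>

definition finite_subgraph :: "'a ugraph \<Rightarrow> 'a ugraph \<Rightarrow> bool" where
  "finite_subgraph H G \<longleftrightarrow>
     simple_graph H \<and> finite (verts H) \<and> verts H \<noteq> {} \<and>
     verts H \<subseteq> verts G \<and> edges H \<subseteq> edges G"

datatype edge_label = Near | Far

definition threshold_coloring ::
    "'a ugraph \<Rightarrow> ('a set \<Rightarrow> edge_label) \<Rightarrow> int \<Rightarrow> ('a \<Rightarrow> int) \<Rightarrow> bool" where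
  "threshold_coloring G l t c \<longleftrightarrow>
     t \<ge> 0 \<and> (\<forall>u v. {u, v} \<in> edges G \<longrightarrow> (\<bar>c u - c v\<bar> \<le> t \<longleftrightarrow> l {u, v} = Near))"

text \<open>\<open>Max\<close> and \<open>Min\<close> are meaningful only for finite nonempty graphs; the notions below
  are used only for these.\<close>

definition rt_threshold_coloring ::
    "int \<Rightarrow> int \<Rightarrow> 'a ugraph \<Rightarrow> ('a set \<Rightarrow> edge_label) \<Rightarrow> ('a \<Rightarrow> int) \<Rightarrow> bool" where
  "rt_threshold_coloring r t G l c \<longleftrightarrow>
     threshold_coloring G l t c \<and> r > Max (c ` verts G) - Min (c ` verts G)"

definition total_threshold_colorable :: "int \<Rightarrow> int \<Rightarrow> 'a ugraph \<Rightarrow> bool" where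
  "total_threshold_colorable r t G \<longleftrightarrow> (\<forall>l. \<exists>c. rt_threshold_coloring r t G l c)"

text \<open>Each lattice is the edge skeleton of a tiling by regular polygons of side 1, placed in the
  complex plane. In the three tilings below, two vertices span an edge of a tile iff their
  distance is 1.\<close>

definition unit_distance_graph :: "complex set \<Rightarrow> complex ugraph" where
  "unit_distance_graph V =
     \<lparr>verts = V, edges = {{u, v} | u v. u \<in> V \<and> v \<in> V \<and> dist u v = 1}\<rparr>"

definition square_lattice :: "complex ugraph" where
  "square_lattice = unit_distance_graph {Complex (of_int a) (of_int b) | a b :: int. True}"

text \<open>(3,6,3,6): the unit triangular lattice without the points whose two coordinates are both
  odd; these are the centres of the hexagons.\<close>

definition trihexagonal_lattice :: "complex ugraph" where
  "trihexagonal_lattice = unit_distance_graph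
     {of_int a + of_int b * cis (pi / 3) | a b :: int. \<not> (odd a \<and> odd b)}"

text \<open>(3,4,6,4): the corners \<open>cis (k * pi / 3)\<close> of unit hexagons centred at the points of a
  triangular lattice. Neighbouring hexagons face each other across a unit square, so their
  centres are \<open>1 + sqrt 3\<close> apart (twice the apothem plus 1), in a direction orthogonal to a
  hexagon side, whence the factor \<open>cis (pi / 6)\<close>.\<close>

definition rhombitrihexagonal_lattice :: "complex ugraph" where
  "rhombitrihexagonal_lattice = unit_distance_graph
     {of_real (1 + sqrt 3) * cis (pi / 6) * (of_int a + of_int b * cis (pi / 3))
        + cis (of_int k * pi / 3) | a b k :: int. True}"

text \<open>A graph whose vertices are points of the plane is drawn with straight edges:
  \<open>convex hull {u, v}\<close> is the segment from \<open>u\<close> to \<open>v\<close>. The drawings of the lattices above have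
  no crossings, and their faces are the connected components of the complement.\<close>

definition drawing :: "complex ugraph \<Rightarrow> complex set" where
  "drawing G = verts G \<union> (\<Union>e\<in>edges G. convex hull e)"

definition faces :: "complex ugraph \<Rightarrow> complex set set" where
  "faces G = components (- drawing G)"

text \<open>Two distinct faces are adjacent in the planar dual iff some edge lies on the boundary of
  both. Parallel dual edges are identified, which is immaterial for the lattices above, where
  two faces share at most one edge.\<close>

definition planar_dual :: "complex ugraph \<Rightarrow> complex set ugraph" where
  "planar_dual G =
     \<lparr>verts = faces G,
      edges = {{f, g} | f g. f \<in> faces G \<and> g \<in> faces G \<and> f \<noteq> g \<and>
                 (\<exists>e\<in>edges G. convex hull e \<subseteq> frontier f \<inter> frontier g)}\<rparr>"

end

(* All faces of the three lattices are 4-cycles around the vertices of a 4-regular tiling. If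
   exactly two of the edges of a 4-cycle are far, then the far edges are oriented (from the lower to
   the higher color) to the same side of the curve that crosses them. So label far the dual edges
   crossed by a path in the 4-regular tiling: one side of the path is higher all along it. If
   the path spirals outward such that a ray crosses its windings by alternately far and near
   steps, then every far step goes, say, up by more than t, and every near step down by at
   most t. The colors along the ray are thus strictly monotone, whatever t is, and r + 1 windings
   exceed the range r. In each of the three tilings, the spiral is an Ulam spiral in a
   (subdivided) square grid contained in the tiling.

   The faces of a tiling are its open tiles, since in a set of points with mutual distance at
   least 1 two segments of length 1 cannot cross. *)

theory Submission
  imports Defs
begin

subsection \<open>Colorings along a spiral\<close>

text \<open>Two far edges of a 4-cycle fix each other's direction because, if both went up in the
  cyclic order, they would climb by more than \<open>2 * t\<close>, and the two near edges could not
  make up for that. This treats opposite and consecutive far edges alike, so the path may turn at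
  any vertex. Concentric closed curves would not do: the higher side could be chosen for each curve
  separately. The spiral is one path through all windings, so the choice at one edge settles all of
  them. A far step is at least \<open>t + 1\<close> and a near step at most \<open>t\<close>, so a
  winding may gain as little as 1; but this gain is the same for every \<open>t\<close>, and one
  finite graph with one labeling serves all thresholds. The obstacle in the dual lattices is that
  faces are components of the complement of a drawing. The tiles are therefore described as open
  polygons cut out by half-planes, and a polygon is recognized as a face by metric facts alone: its
  circumcircle contains no vertex in its interior, and its frontier consists of unit edges.\<close>

text \<open>\<open>spiral_h i j\<close> and \<open>spiral_v i j\<close> say that the edge from \<open>(i, j)\<close> to \<open>(i + 1, j)\<close>,
  respectively \<open>(i, j + 1)\<close>, lies on the Ulam spiral, a path through all points of the integer grid
  that starts at the origin, runs counterclockwise and turns at the corners of the squares around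
  the origin.\<close>

definition spiral_h :: "int \<Rightarrow> int \<Rightarrow> bool" where
  "spiral_h i j \<longleftrightarrow> (if j > 0 then -j \<le> i \<and> i < j else j \<le> i \<and> i \<le> -j)"

definition spiral_v :: "int \<Rightarrow> int \<Rightarrow> bool" where
  "spiral_v i j \<longleftrightarrow> (if i > 0 then -i < j \<and> j < i else i \<le> j \<and> j < -i)"

lemma int_chain:
  fixes m n :: int and P :: "int \<Rightarrow> bool"
  assumes "m \<le> n" "\<And>i. m \<le> i \<Longrightarrow> i < n \<Longrightarrow> P i = P (i + 1)"
  shows "P m = P n"
  using assms
proof (induction n rule: int_ge_induct)
  case (step i)
  then show ?case by (metis order_less_le_trans less_add_one zless_add1_eq order_refl)
qed simp

text \<open>\<open>nw i j\<close>, \<open>ne i j\<close>, \<open>sw i j\<close> and \<open>se i j\<close> are the colors of the four faces around the grid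
  point \<open>(i, j)\<close>. The grid edges may be paths of the actual lattice; the link assumptions
  say that the higher side of a spiral edge is the same at both ends. At a grid point, the higher
  side passes from one of its two spiral edges to the other, because the remaining two dual edges
  are near. Following a full turn of the spiral, the higher sides of consecutive windings agree,
  and walking down the ray below the origin alternates far steps, all in the same direction,
  with near steps.\<close>

lemma spiral_spread:
  fixes ne nw se sw :: "int \<Rightarrow> int \<Rightarrow> int" and t N :: int
  assumes "N \<ge> 1"
  and nwne: "\<And>i j. \<bar>i\<bar> \<le> N \<Longrightarrow> \<bar>j\<bar> \<le> N \<Longrightarrow> \<bar>nw i j - ne i j\<bar> > t \<longleftrightarrow> spiral_v i j"
  and swse: "\<And>i j. \<bar>i\<bar> \<le> N \<Longrightarrow> \<bar>j\<bar> \<le> N \<Longrightarrow> \<bar>sw i j - se i j\<bar> > t \<longleftrightarrow> spiral_v i (j - 1)"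
  and sene: "\<And>i j. \<bar>i\<bar> \<le> N \<Longrightarrow> \<bar>j\<bar> \<le> N \<Longrightarrow> \<bar>se i j - ne i j\<bar> > t \<longleftrightarrow> spiral_h i j"
  and swnw: "\<And>i j. \<bar>i\<bar> \<le> N \<Longrightarrow> \<bar>j\<bar> \<le> N \<Longrightarrow> \<bar>sw i j - nw i j\<bar> > t \<longleftrightarrow> spiral_h (i - 1) j"
  and link_v: "\<And>i j. \<bar>i\<bar> \<le> N \<Longrightarrow> \<bar>j\<bar> \<le> N \<Longrightarrow> spiral_v i j \<Longrightarrow>
      nw i j < ne i j \<longleftrightarrow> sw i (j + 1) < se i (j + 1)"
  and link_h: "\<And>i j. \<bar>i\<bar> \<le> N \<Longrightarrow> \<bar>j\<bar> \<le> N \<Longrightarrow> spiral_h i j \<Longrightarrow>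
      se i j < ne i j \<longleftrightarrow> sw (i + 1) j < nw (i + 1) j"
  and ray: "\<And>j. \<bar>j\<bar> \<le> N \<Longrightarrow> \<bar>nw 0 (j - 1) - sw 0 j\<bar> \<le> t"
  shows "\<exists>a b. \<bar>a\<bar> \<le> N \<and> \<bar>b\<bar> \<le> N \<and> sw 0 a - sw 0 b \<ge> N - 1"
proof -
  define p where "p i j \<longleftrightarrow> se i j < ne i j" for i j
  define q where "q i j \<longleftrightarrow> nw i j < ne i j" for i j
  have p': "sw i j < nw i j \<longleftrightarrow> p (i - 1) j"
    if "\<bar>i - 1\<bar> \<le> N" "\<bar>j\<bar> \<le> N" "spiral_h (i - 1) j" for i j
    using link_h[OF that] by (simp add: p_def)
  have q': "sw i j < se i j \<longleftrightarrow> q i (j - 1)"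
    if "\<bar>i\<bar> \<le> N" "\<bar>j - 1\<bar> \<le> N" "spiral_v i (j - 1)" for i j
    using link_v[OF that] by (simp add: q_def)
  note star = nwne swse sene swnw
  \<comment> \<open>The two spiral edges at a grid point pass straight in two ways and turn in four;
    the turns are named by the directions of the edges. Each case is the 4-cycle argument for
    \<open>sw\<close>, \<open>se\<close>, \<open>ne\<close>, \<open>nw\<close>. The negations in
    \<open>left_up\<close> and \<open>right_down\<close> arise because the face inside such a turn
    is above or below one edge but, respectively, left or right of the other.\<close>
  have straight_h: "p (i - 1) j = p i j"
    if b: "\<bar>i\<bar> \<le> N" "\<bar>i - 1\<bar> \<le> N" "\<bar>j\<bar> \<le> N" and
      s: "spiral_h (i - 1) j" "spiral_h i j" "\<not> spiral_v i j" "\<not> spiral_v i (j - 1)" for i j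
    using star[OF b(1,3)] s p'[OF b(2,3) s(1)] p_def[of i j] by linarith
  have straight_v: "q i (j - 1) = q i j"
    if b: "\<bar>i\<bar> \<le> N" "\<bar>j\<bar> \<le> N" "\<bar>j - 1\<bar> \<le> N" and
      s: "\<not> spiral_h (i - 1) j" "\<not> spiral_h i j" "spiral_v i j" "spiral_v i (j - 1)" for i j
    using star[OF b(1,2)] s q'[OF b(1,3) s(4)] q_def[of i j] by linarith
  have left_up: "p (i - 1) j \<longleftrightarrow> \<not> q i j"
    if b: "\<bar>i\<bar> \<le> N" "\<bar>i - 1\<bar> \<le> N" "\<bar>j\<bar> \<le> N" and
      s: "spiral_h (i - 1) j" "\<not> spiral_h i j" "spiral_v i j" "\<not> spiral_v i (j - 1)" for i j
    using star[OF b(1,3)] s p'[OF b(2,3) s(1)] q_def[of i j] by linarith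
  have left_down: "p (i - 1) j \<longleftrightarrow> q i (j - 1)"
    if b: "\<bar>i\<bar> \<le> N" "\<bar>i - 1\<bar> \<le> N" "\<bar>j\<bar> \<le> N" "\<bar>j - 1\<bar> \<le> N" and
      s: "spiral_h (i - 1) j" "\<not> spiral_h i j" "\<not> spiral_v i j" "spiral_v i (j - 1)" for i j
    using star[OF b(1,3)] s p'[OF b(2,3) s(1)] q'[OF b(1,4) s(4)] by linarith
  have right_down: "p i j \<longleftrightarrow> \<not> q i (j - 1)"
    if b: "\<bar>i\<bar> \<le> N" "\<bar>j\<bar> \<le> N" "\<bar>j - 1\<bar> \<le> N" and
      s: "\<not> spiral_h (i - 1) j" "spiral_h i j" "\<not> spiral_v i j" "spiral_v i (j - 1)" for i j
    using star[OF b(1,2)] s p_def[of i j] q'[OF b(1,3) s(4)] by linarith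
  have right_up: "p i j \<longleftrightarrow> q i j"
    if b: "\<bar>i\<bar> \<le> N" "\<bar>j\<bar> \<le> N" and
      s: "\<not> spiral_h (i - 1) j" "spiral_h i j" "spiral_v i j" "\<not> spiral_v i (j - 1)" for i j
    using star[OF b] s p_def[of i j] q_def[of i j] by linarith
  note spiral = spiral_h_def spiral_v_def
  \<comment> \<open>One winding, counterclockwise from one bottom side to the next one below it,
    through the corners \<open>(k + 1, -k)\<close>, \<open>(k + 1, k + 1)\<close>,
    \<open>(-k - 1, k + 1)\<close> and \<open>(-k - 1, -k - 1)\<close>. The negations at the first
    and third corner cancel. It starts at \<open>-1\<close> because the ray crosses the edges from
    \<open>(-1, -k)\<close> to \<open>(0, -k)\<close>.\<close>
  have turn: "p (-1) (-k) = p (-1) (-k - 1)" if k: "1 \<le> k" "k < N" for k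
  proof -
    have "p (-1) (-k) = p k (-k)"
    proof (rule int_chain[where P = "\<lambda>i. p i (-k)"])
      show "p i (-k) = p (i + 1) (-k)" if "-1 \<le> i" "i < k" for i
        using straight_h[of "i + 1" "-k"] that k by (simp add: spiral)
    qed (use k in simp)
    also have "\<dots> \<longleftrightarrow> \<not> q (k + 1) (-k)"
      using left_up[of "k + 1" "-k"] k by (simp add: spiral)
    also have "q (k + 1) (-k) = q (k + 1) k"
    proof (rule int_chain[where P = "\<lambda>j. q (k + 1) j"])
      show "q (k + 1) j = q (k + 1) (j + 1)" if "-k \<le> j" "j < k" for j
        using straight_v[of "k + 1" "j + 1"] that k by (simp add: spiral)
    qed (use k in simp)
    also have "q (k + 1) k \<longleftrightarrow> p k (k + 1)"
      using left_down[of "k + 1" "k + 1"] k by (simp add: spiral)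
    also have "p k (k + 1) = p (-k - 1) (k + 1)"
    proof (rule int_chain[where P = "\<lambda>i. p i (k + 1)", symmetric])
      show "p i (k + 1) = p (i + 1) (k + 1)" if "-k - 1 \<le> i" "i < k" for i
        using straight_h[of "i + 1" "k + 1"] that k by (simp add: spiral)
    qed (use k in simp)
    also have "p (-k - 1) (k + 1) \<longleftrightarrow> \<not> q (-k - 1) k"
      using right_down[of "-k - 1" "k + 1"] k by (simp add: spiral)
    also have "q (-k - 1) k = q (-k - 1) (-k - 1)"
    proof (rule int_chain[where P = "\<lambda>j. q (-k - 1) j", symmetric])
      show "q (-k - 1) j = q (-k - 1) (j + 1)" if "-k - 1 \<le> j" "j < k" for j
        using straight_v[of "-k - 1" "j + 1"] that k by (simp add: spiral)
    qed (use k in simp)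
    also have "q (-k - 1) (-k - 1) \<longleftrightarrow> p (-k - 1) (-k - 1)"
      using right_up[of "-k - 1" "-k - 1"] k by (simp add: spiral)
    also have "p (-k - 1) (-k - 1) = p (-1) (-k - 1)"
    proof (rule int_chain[where P = "\<lambda>i. p i (-k - 1)"])
      show "p i (-k - 1) = p (i + 1) (-k - 1)" if "-k - 1 \<le> i" "i < -1" for i
        using straight_h[of "i + 1" "-k - 1"] that k by (simp add: spiral)
    qed (use k in simp)
    finally show ?thesis by simp
  qed
  have up: "sw 0 (-k) < nw 0 (-k) \<longleftrightarrow> p (-1) (-1)" if "1 \<le> k" "k \<le> N" for k
  proof -
    have "p (-1) (-1) = p (-1) (-k)"
      by (rule int_chain[where P = "\<lambda>k. p (-1) (-k)" and m = 1])
        (use that turn in auto)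
    then show ?thesis
      using p'[of 0 "-k"] that by (simp add: spiral)
  qed
  \<comment> \<open>From \<open>sw 0 (-k - 1)\<close> a far step crosses the winding to
    \<open>nw 0 (-k - 1)\<close>, and \<open>ray\<close> leads from there to
    \<open>sw 0 (-k)\<close>; the far step outweighs the near one.\<close>
  have drop: "if p (-1) (-1) then sw 0 (-k) > sw 0 (-k - 1) else sw 0 (-k) < sw 0 (-k - 1)"
    if k: "1 \<le> k" "k < N" for k
    using swnw[of 0 "-k - 1"] up[of "k + 1"] ray[of "-k"] k
    by (auto simp: spiral)
  have "if p (-1) (-1) then sw 0 (-1) - sw 0 (-k) \<ge> k - 1 else sw 0 (-k) - sw 0 (-1) \<ge> k - 1"
    if "1 \<le> k" "k \<le> N" for k
    using that
  proof (induction k rule: int_ge_induct)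
    case (step i)
    then show ?case
      using drop[of i] by (simp split: if_splits)
  qed simp
  from this[of N] show ?thesis
    using assms(1) by (auto split: if_splits) (metis abs_minus abs_one abs_of_nonneg order_refl
      order_trans zero_le_one)+
qed

text \<open>Moves the problem to an index type on which edges and labels are explicit; injectivity
  of \<open>\<phi>\<close> lets the label of an edge be read off from its preimage. Neither the
  subgraph nor the labeling depends on \<open>t\<close>. A spread of \<open>r\<close> contradicts
  the strict inequality in the definition of a range.\<close>

lemma not_colorable_subgraph:
  fixes \<phi> :: "'i \<Rightarrow> 'a" and r :: int
  assumes inj: "inj \<phi>" and verts: "\<And>u. \<phi> u \<in> verts G"
  and edges: "\<And>e. e \<in> E \<Longrightarrow> \<phi> ` e \<in> edges G" and card2: "\<And>e. e \<in> E \<Longrightarrow> card e = 2"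
  and B: "finite B" "B \<noteq> {}"
  and spread: "\<And>t x. t \<ge> 0 \<Longrightarrow>
      (\<And>u v. {u, v} \<in> E \<Longrightarrow> u \<in> B \<Longrightarrow> v \<in> B \<Longrightarrow> \<bar>x u - x v\<bar> > t \<longleftrightarrow> {u, v} \<in> F) \<Longrightarrow>
      \<exists>u\<in>B. \<exists>v\<in>B. r \<le> x u - x v"
  shows "\<exists>H. finite_subgraph H G \<and> (\<forall>t\<ge>0. \<not> total_threshold_colorable r t H)"
proof -
  define H where "H = \<lparr>verts = \<phi> ` B, edges = (`) \<phi> ` {e \<in> E. e \<subseteq> B}\<rparr>"
  have "finite_subgraph H G"
    unfolding finite_subgraph_def simple_graph_def H_def
    using B verts edges card2 card_image[OF inj_on_subset[OF inj subset_UNIV]] by auto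
  moreover have "\<not> total_threshold_colorable r t H" if "t \<ge> 0" for t
  proof
    assume "total_threshold_colorable r t H"
    then obtain c where c: "rt_threshold_coloring r t H (\<lambda>e. if e \<in> (`) \<phi> ` F then Far else Near) c"
      unfolding total_threshold_colorable_def by blast
    have "\<bar>c (\<phi> u) - c (\<phi> v)\<bar> > t \<longleftrightarrow> {u, v} \<in> F" if "{u, v} \<in> E" "u \<in> B" "v \<in> B" for u v
    proof -
      have "{\<phi> u, \<phi> v} = \<phi> ` {u, v}" by simp
      moreover from this have "{\<phi> u, \<phi> v} \<in> edges H"
        unfolding H_def using that by (auto intro!: imageI simp del: image_insert)
      moreover have "\<phi> ` {u, v} \<in> (`) \<phi> ` F \<longleftrightarrow> {u, v} \<in> F"
        using inj by (metis (no_types, lifting) image_iff inj_image_eq_iff)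
      ultimately show ?thesis
        using c unfolding rt_threshold_coloring_def threshold_coloring_def
        by (smt (verit) edge_label.distinct(1))
    qed
    then obtain u v where uv: "u \<in> B" "v \<in> B" "r \<le> c (\<phi> u) - c (\<phi> v)"
      using spread[OF \<open>t \<ge> 0\<close>, of "c \<circ> \<phi>"] by auto
    have "c (\<phi> u) \<le> Max (c ` verts H)" "Min (c ` verts H) \<le> c (\<phi> v)"
      using uv B unfolding H_def by auto
    then show False
      using c uv(3) unfolding rt_threshold_coloring_def by linarith
  qed
  ultimately show ?thesis by blast
qed

section \<open>The square lattice\<close>

lemma square_lattice_obstruction:
  fixes r :: int
  assumes "r > 0"
  shows "\<exists>H. finite_subgraph H square_lattice \<and> (\<forall>t\<ge>0. \<not> total_threshold_colorable r t H)"
proof -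
  define \<phi> :: "int \<times> int \<Rightarrow> complex" where "\<phi> = (\<lambda>(i, j). Complex (of_int i) (of_int j))"
  define E where "E = (\<Union>i j. {{(i - 1, j), (i, j :: int)}, {(i :: int, j - 1), (i, j)}})"
  \<comment> \<open>The spiral runs on the dual grid: its point \<open>(i, j)\<close> is the center
    of the unit square with upper right corner \<open>(i, j)\<close>, so its vertical steps cross
    horizontal lattice edges and conversely.\<close>
  define F where "F = {{(i - 1, j), (i, j)} | i j. spiral_v i j} \<union> {{(i, j - 1), (i, j)} | i j.
    spiral_h i j}"
  \<comment> \<open>The spiral has radius \<open>r + 1\<close>, for a spread of \<open>r\<close>.
    The margin of 2 covers neighboring indices such as \<open>j - 1\<close> and the other ends of
    the edges attached to them.\<close>
  define B where "B = {-r - 3..r + 3} \<times> {-r - 3..r + 3}"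
  have F: "{(i - 1, j), (i, j)} \<in> F \<longleftrightarrow> spiral_v i j" "{(i, j - 1), (i, j)} \<in> F \<longleftrightarrow> spiral_h i j" for i
    j
    unfolding F_def by (auto simp: doubleton_eq_iff)
  show ?thesis
  proof (rule not_colorable_subgraph[where \<phi> = \<phi> and E = E and B = B and F = F])
    show "inj \<phi>" by (auto simp: inj_def \<phi>_def)
    show "\<phi> u \<in> verts square_lattice" for u
      by (auto simp: \<phi>_def square_lattice_def unit_distance_graph_def split: prod.split)
    have dist: "dist (Complex (of_int i - 1) (of_int j)) (Complex (of_int i) (of_int j)) = 1"
      "dist (Complex (of_int i) (of_int j - 1)) (Complex (of_int i) (of_int j)) = 1" for i j
      by (auto simp: dist_norm complex_diff complex_norm)
    show "\<phi> ` e \<in> edges square_lattice" if "e \<in> E" for e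
    proof -
      have "{\<phi> u, \<phi> v} \<in> edges square_lattice" if "dist (\<phi> u) (\<phi> v) = 1" for u v
        using that unfolding square_lattice_def unit_distance_graph_def \<phi>_def
        by (cases u, cases v) (simp, blast)
      moreover have "dist (\<phi> (i - 1, j)) (\<phi> (i, j)) = 1" "dist (\<phi> (i, j - 1)) (\<phi> (i, j)) = 1" for i
        j
        using dist by (simp_all add: \<phi>_def)
      ultimately show ?thesis using that unfolding E_def by auto
    qed
    show "card e = 2" if "e \<in> E" for e
      using that unfolding E_def by auto
    show "finite B" "B \<noteq> {}" using assms unfolding B_def by auto
    fix t :: int and x :: "int \<times> int \<Rightarrow> int"
    assume "t \<ge> 0" and x: "\<And>u v. {u, v} \<in> E \<Longrightarrow> u \<in> B \<Longrightarrow> v \<in> B \<Longrightarrow> \<bar>x u - x v\<bar> > t \<longleftrightarrow> {u, v} \<in> F"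
    have v: "\<bar>x (i - 1, j) - x (i, j)\<bar> > t \<longleftrightarrow> spiral_v i j"
      and h: "\<bar>x (i, j - 1) - x (i, j)\<bar> > t \<longleftrightarrow> spiral_h i j"
      if "\<bar>i\<bar> \<le> r + 2" "\<bar>j\<bar> \<le> r + 2" for i j
      by (subst x; use that in \<open>auto simp: E_def B_def F\<close>)+
    have "\<exists>a b. \<bar>a\<bar> \<le> r + 1 \<and> \<bar>b\<bar> \<le> r + 1 \<and> x (-1, a - 1) - x (-1, b - 1) \<ge> r + 1 - 1"
      using spiral_spread[where N = "r + 1" and t = t and nw = "\<lambda>i j. x (i - 1, j)" and ne = "\<lambda>i j.
        x (i, j)"
          and sw = "\<lambda>i j. x (i - 1, j - 1)" and se = "\<lambda>i j. x (i, j - 1)"] v h \<open>r > 0\<close> \<open>t \<ge> 0\<close> by simp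
    then obtain a b where "\<bar>a\<bar> \<le> r + 1" "\<bar>b\<bar> \<le> r + 1" "x (-1, a - 1) - x (-1, b - 1) \<ge> r"
      by auto
    then show "\<exists>u\<in>B. \<exists>v\<in>B. r \<le> x u - x v"
      by (intro bexI[of _ "(-1, a - 1)"] bexI[of _ "(-1, b - 1)"]) (auto simp: B_def)
  qed
qed

subsection \<open>Regular polygons as faces\<close>

text \<open>Two properly crossing segments are the diagonals of a convex quadrilateral. If its sides have
  length at least 1, then, since one angle is not acute, a diagonal has length at least the square
  root of 2.\<close>

lemma unit_segments_cross_aux:
  fixes x y p q z :: "'a::real_inner"
  assumes unit: "dist x y = 1" "dist p q = 1"
  and z: "z \<in> closed_segment x y" "z \<in> closed_segment p q"
  and sep: "\<And>a b. a \<in> {x, y} \<Longrightarrow> b \<in> {p, q} \<Longrightarrow> a = b \<or> dist a b \<ge> 1"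
  and pos: "inner (y - x) (q - p) \<ge> 0"
  shows "{x, y} = {p, q} \<or> z \<in> {x, y} \<inter> {p, q}"
proof -
  obtain s where s: "0 \<le> s" "s \<le> 1" "z = x + s *\<^sub>R (y - x)"
    using z(1) by (auto simp: in_segment algebra_simps)
  obtain w where w: "0 \<le> w" "w \<le> 1" "z = p + w *\<^sub>R (q - p)"
    using z(2) by (auto simp: in_segment algebra_simps)
  define d e where "d = y - x" and "e = q - p"
  have n: "norm d = 1" "norm e = 1"
    using unit by (auto simp: d_def e_def dist_norm norm_minus_commute)
  then have n2: "inner d d = 1" "inner e e = 1" by (simp_all add: dot_square_norm)
  have xp: "x - p = w *\<^sub>R e - s *\<^sub>R d" using s w by (simp add: d_def e_def algebra_simps)
  have yq: "y - q = (1 - s) *\<^sub>R d - (1 - w) *\<^sub>R e" using xp by (simp add: d_def e_def algebra_simps)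
  have bound: "(norm (a *\<^sub>R d - b *\<^sub>R e))\<^sup>2 \<le> a\<^sup>2 + b\<^sup>2" if "a \<ge> 0" "b \<ge> 0" for a b
  proof -
    have "(norm (a *\<^sub>R d - b *\<^sub>R e))\<^sup>2 = a\<^sup>2 + b\<^sup>2 - 2 * (a * b) * inner d e"
      unfolding power2_norm_eq_inner inner_diff_left inner_diff_right
      by (simp add: n2 inner_commute power2_eq_square algebra_simps)
    then show ?thesis using that pos by (simp add: d_def e_def)
  qed
  consider "x = p" | "y = q" | "x \<noteq> p" "y \<noteq> q" by blast
  then show ?thesis
  proof cases
    case 1
    then have "w *\<^sub>R e = s *\<^sub>R d" using xp by simp
    moreover from this have "w = s" using n s(1) w(1) by (metis abs_of_nonneg mult.right_neutral
      norm_scaleR)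
    ultimately show ?thesis using 1 s w by (cases "s = 0") (auto simp: d_def e_def)
  next
    case 2
    then have "(1 - s) *\<^sub>R d = (1 - w) *\<^sub>R e" using yq by simp
    moreover from this have "1 - w = 1 - s" using n s(2) w(2)
      by (metis abs_of_nonneg diff_ge_0_iff_ge mult.right_neutral norm_scaleR)
    ultimately show ?thesis using 2 s w by (cases "s = 1") (auto simp: d_def e_def)
  next
    case 3
    \<comment> \<open>Since squares do not exceed their roots on the unit interval, the first bound
      below gives \<open>s + w \<ge> 1\<close> and the second \<open>s + w \<le> 1\<close>. Equality
      makes \<open>s\<close> and \<open>w\<close> 0 or 1, so the segments meet in an endpoint of
      both.\<close>
    have "1 \<le> (norm (x - p))\<^sup>2" "1 \<le> (norm (y - q))\<^sup>2"
      using sep[of x p] sep[of y q] 3 by (auto simp: dist_norm one_le_power)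
    then have "1 \<le> s\<^sup>2 + w\<^sup>2" "1 \<le> (1 - s)\<^sup>2 + (1 - w)\<^sup>2"
      using bound[of s w] bound[of "1 - s" "1 - w"] s w xp yq
      by (auto simp: norm_minus_commute)
    moreover have "s\<^sup>2 \<le> s" "w\<^sup>2 \<le> w"
      using s w by (auto simp: power2_eq_square mult_left_le)
    moreover have "(1 - s)\<^sup>2 + (1 - w)\<^sup>2 = 2 - 2 * s - 2 * w + s\<^sup>2 + w\<^sup>2"
      by (simp add: power2_diff)
    ultimately have "s + w = 1" "s\<^sup>2 = s" by linarith+
    then have "s = 0 \<and> w = 1 \<or> s = 1 \<and> w = 0" by (auto simp: power2_eq_square)
    then show ?thesis using s w by auto
  qed
qed

lemma unit_segments_cross:
  fixes x y p q z :: "'a::real_inner"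
  assumes "dist x y = 1" "dist p q = 1"
  and "z \<in> closed_segment x y" "z \<in> closed_segment p q"
  and "\<And>a b. a \<in> {x, y} \<Longrightarrow> b \<in> {p, q} \<Longrightarrow> a = b \<or> dist a b \<ge> 1"
  shows "{x, y} = {p, q} \<or> z \<in> {x, y} \<inter> {p, q}"
proof (cases "inner (y - x) (q - p) \<ge> 0")
  case True
  show ?thesis using unit_segments_cross_aux[OF assms True] .
next
  case False
  then have "inner (y - x) (p - q) \<ge> 0" by (simp add: inner_diff_right)
  then have "{x, y} = {q, p} \<or> z \<in> {x, y} \<inter> {q, p}"
    using assms(2,4,5) by (intro unit_segments_cross_aux[OF assms(1) _ assms(3)])
      (auto simp: dist_commute[of q p] closed_segment_commute[of q p])
  then show ?thesis by (simp add: insert_commute)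
qed

section \<open>Geometry of a regular polygon with sides of length 1\<close>

text \<open>For \<open>Z\<close> the \<open>n\<close>-th roots of unity and \<open>\<epsilon> = cis (2 * pi / n)\<close>, this is the open regular \<open>n\<close>-gon
  with center \<open>c\<close> and a corner at \<open>c + w\<close>: the direction \<open>w * (1 + \<epsilon>) * \<eta>\<close> is normal to the side
  between \<open>c + w * \<eta>\<close> and \<open>c + w * \<eta> * \<epsilon>\<close>.\<close>

definition polygon :: "complex \<Rightarrow> complex set \<Rightarrow> complex \<Rightarrow> complex \<Rightarrow> complex set" where
  "polygon \<epsilon> Z c w = {z. \<forall>\<eta>\<in>Z. inner (w * (1 + \<epsilon>) * \<eta>) (z - c) < (norm w)\<^sup>2 * (1 + Re \<epsilon>)}"

definition corners :: "complex set \<Rightarrow> complex \<Rightarrow> complex \<Rightarrow> complex set" where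
  "corners Z c w = (\<lambda>\<eta>. c + w * \<eta>) ` Z"

text \<open>\<open>gen_Re\<close> says that \<open>\<epsilon>\<close> and
  \<open>cnj \<epsilon>\<close> are the neighbors of 1 in the group \<open>Z\<close>, and
  \<open>side\<close> normalizes the side length. For the triangle, square and hexagon, all of this
  can be checked by enumerating \<open>Z\<close>.\<close>

locale unit_polygon =
  fixes \<epsilon> :: complex and Z :: "complex set" and c w :: complex
  assumes fin: "finite Z" and unit: "\<And>\<eta>. \<eta> \<in> Z \<Longrightarrow> norm \<eta> = 1"
  and group: "\<And>\<eta> \<theta>. \<eta> \<in> Z \<Longrightarrow> \<theta> \<in> Z \<Longrightarrow> \<eta> * cnj \<theta> \<in> Z"
  and gen: "\<epsilon> \<in> Z" and gen_Im: "Im \<epsilon> \<noteq> 0"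
  and gen_Re: "\<And>\<eta>. \<eta> \<in> Z \<Longrightarrow> \<eta> \<in> {1, \<epsilon>, cnj \<epsilon>} \<or> Re \<eta> < Re \<epsilon>"
  and side: "norm (w * (\<epsilon> - 1)) = 1"
begin

definition lev :: "complex \<Rightarrow> complex \<Rightarrow> real" where
  "lev \<eta> z = inner (w * (1 + \<epsilon>) * \<eta>) (z - c)"

text \<open>The value of \<open>lev \<eta>\<close> at both ends of the side that belongs to
  \<open>\<eta>\<close>, namely \<open>c + w * \<eta>\<close> and
  \<open>c + w * (\<epsilon> * \<eta>)\<close>.\<close>

definition top_lev :: real where "top_lev = (norm w)\<^sup>2 * (1 + Re \<epsilon>)"

lemma mem_polygon: "z \<in> polygon \<epsilon> Z c w \<longleftrightarrow> (\<forall>\<eta>\<in>Z. lev \<eta> z < top_lev)"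
  by (simp add: polygon_def lev_def top_lev_def)

lemma mult_cnj_unit: "\<eta> \<in> Z \<Longrightarrow> \<eta> * cnj \<eta> = 1"
  using unit by (simp add: complex_norm_square[symmetric])

lemma cnj_mult_unit: "\<eta> \<in> Z \<Longrightarrow> cnj \<eta> * \<eta> = 1"
  using mult_cnj_unit by (simp add: mult.commute)

lemma one_in: "1 \<in> Z"
  using group[OF gen gen] mult_cnj_unit[OF gen] by simp

lemma cnj_in: "\<eta> \<in> Z \<Longrightarrow> cnj \<eta> \<in> Z"
  using group[OF one_in] by simp

lemma mult_in: "\<eta> \<in> Z \<Longrightarrow> \<theta> \<in> Z \<Longrightarrow> \<eta> * \<theta> \<in> Z"
  using group[OF _ cnj_in] by simp

lemma gen_square: "(Re \<epsilon>)\<^sup>2 + (Im \<epsilon>)\<^sup>2 = 1"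
  using unit[OF gen] by (simp add: cmod_def)

lemma gen_Re_bounds: "-1 < Re \<epsilon>" "Re \<epsilon> < 1"
proof -
  have "(Re \<epsilon>)\<^sup>2 < 1" using gen_square gen_Im by (smt (verit) zero_less_power2)
  then show "-1 < Re \<epsilon>" "Re \<epsilon> < 1" by (auto simp: abs_square_less_1)
qed

lemma w_nonzero: "w \<noteq> 0"
  using side by auto

lemma top_lev_pos: "0 < top_lev"
  using gen_Re_bounds w_nonzero by (simp add: top_lev_def)

lemma lev_eq: "\<eta> \<in> Z \<Longrightarrow> \<theta> \<in> Z \<Longrightarrow>
    lev \<theta> (c + w * (\<eta> * y)) = (norm w)\<^sup>2 * Re (y * cnj (1 + \<epsilon>) * (\<eta> * cnj \<theta>))"
  unfolding lev_def inner_complex_def cmod_power2 by (simp add: power2_eq_square algebra_simps)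

text \<open>The side with the largest level spans the sector that contains \<open>z\<close>: comparison with
  the two neighboring sides shows that the coordinates of \<open>z\<close> in this sector are nonnegative.\<close>

lemma sector:
  obtains \<eta> \<alpha> \<beta> where "\<eta> \<in> Z" "\<alpha> \<ge> 0" "\<beta> \<ge> 0"
    "z = c + w * \<eta> * (of_real \<alpha> + of_real \<beta> * \<epsilon>)" "lev \<eta> z = (\<alpha> + \<beta>) * top_lev"
    "\<And>\<theta>. \<theta> \<in> Z \<Longrightarrow> lev \<theta> z \<le> lev \<eta> z"
proof -
  obtain \<eta> where \<eta>: "\<eta> \<in> Z" "\<And>\<theta>. \<theta> \<in> Z \<Longrightarrow> lev \<theta> z \<le> lev \<eta> z"
  proof -
    obtain \<eta> where "\<eta> \<in> Z" "Max ((\<lambda>\<theta>. lev \<theta> z) ` Z) = lev \<eta> z"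
      using obtains_MAX[OF fin] one_in by blast
    moreover from this have "lev \<theta> z \<le> lev \<eta> z" if "\<theta> \<in> Z" for \<theta>
      using Max_ge[of "(\<lambda>\<theta>. lev \<theta> z) ` Z" "lev \<theta> z"] fin that by simp
    ultimately show ?thesis using that by blast
  qed
  define y where "y = (z - c) / (w * \<eta>)"
  have "\<eta> \<noteq> 0" using unit[OF \<eta>(1)] by auto
  then have z: "z = c + w * (\<eta> * y)" using w_nonzero by (simp add: y_def)
  define \<beta> where "\<beta> = Im y / Im \<epsilon>"
  define \<alpha> where "\<alpha> = Re y - \<beta> * Re \<epsilon>"
  have y: "Re y = \<alpha> + \<beta> * Re \<epsilon>" "Im y = \<beta> * Im \<epsilon>"
    using gen_Im by (simp_all add: \<alpha>_def \<beta>_def)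
  then have y': "y = of_real \<alpha> + of_real \<beta> * \<epsilon>" by (simp add: complex_eq_iff)
  have w2: "(norm w)\<^sup>2 > 0" using w_nonzero by simp
  have Im2: "(Im \<epsilon>)\<^sup>2 > 0" using gen_Im by simp
  have sq: "Im \<epsilon> * Im \<epsilon> = 1 - Re \<epsilon> * Re \<epsilon>" using gen_square by (simp add: power2_eq_square)
  have sq': "Im \<epsilon> * (Im \<epsilon> * a) = a - Re \<epsilon> * (Re \<epsilon> * a)" for a
    using arg_cong[OF sq, of "\<lambda>t. t * a"] by (simp add: algebra_simps)
  have l0: "lev \<eta> z = (norm w)\<^sup>2 * ((\<alpha> + \<beta>) * (1 + Re \<epsilon>))"
    unfolding z lev_eq[OF \<eta>(1) \<eta>(1)] mult_cnj_unit[OF \<eta>(1)]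
    by (rule arg_cong[where f = "\<lambda>a. (norm w)\<^sup>2 * a"]) (simp add: y sq sq' algebra_simps)
  have e1: "\<eta> * cnj (\<eta> * \<epsilon>) = cnj \<epsilon>" "\<eta> * cnj (\<eta> * cnj \<epsilon>) = \<epsilon>"
    using mult_cnj_unit[OF \<eta>(1)] by (simp_all add: mult.assoc[symmetric])
  have l1: "lev (\<eta> * \<epsilon>) z = (norm w)\<^sup>2 * ((\<alpha> + \<beta>) * (1 + Re \<epsilon>) - \<alpha> * (2 * (Im \<epsilon>)\<^sup>2))"
    unfolding z lev_eq[OF \<eta>(1) mult_in[OF \<eta>(1) gen]] e1
    by (rule arg_cong[where f = "\<lambda>a. (norm w)\<^sup>2 * a"]) (simp add: y sq sq' power2_eq_square
      algebra_simps)
  have l2: "lev (\<eta> * cnj \<epsilon>) z = (norm w)\<^sup>2 * ((\<alpha> + \<beta>) * (1 + Re \<epsilon>) - \<beta> * (2 * (Im \<epsilon>)\<^sup>2))"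
    unfolding z lev_eq[OF \<eta>(1) group[OF \<eta>(1) gen]] e1
    by (rule arg_cong[where f = "\<lambda>a. (norm w)\<^sup>2 * a"]) (simp add: y sq sq' power2_eq_square
      algebra_simps)
  have "\<alpha> \<ge> 0"
    using \<eta>(2)[OF mult_in[OF \<eta>(1) gen]] w2 Im2 unfolding l0 l1 by (simp add: zero_le_mult_iff)
  moreover have "\<beta> \<ge> 0"
    using \<eta>(2)[OF group[OF \<eta>(1) gen]] w2 Im2 unfolding l0 l2 by (simp add: zero_le_mult_iff)
  ultimately show ?thesis
    using that[of \<eta> \<alpha> \<beta>] \<eta> z y' l0 by (simp add: top_lev_def ac_simps)
qed

lemma polygon_subset_ball: "polygon \<epsilon> Z c w \<subseteq> ball c (norm w)"
proof
  fix z assume z: "z \<in> polygon \<epsilon> Z c w"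
  obtain \<eta> \<alpha> \<beta> where s: "\<eta> \<in> Z" "\<alpha> \<ge> 0" "\<beta> \<ge> 0"
    "z = c + w * \<eta> * (of_real \<alpha> + of_real \<beta> * \<epsilon>)" "lev \<eta> z = (\<alpha> + \<beta>) * top_lev"
    by (rule sector[of z]) blast
  then have "(\<alpha> + \<beta>) * top_lev < 1 * top_lev" using z mem_polygon by auto
  then have "\<alpha> + \<beta> < 1" using top_lev_pos by (simp only: mult_less_cancel_right_pos)
  moreover have "norm (of_real \<alpha> + of_real \<beta> * \<epsilon>) \<le> \<alpha> + \<beta>"
    using norm_triangle_ineq[of "of_real \<alpha>" "of_real \<beta> * \<epsilon>"] s(2,3) unit[OF gen]
    by (simp add: norm_mult)
  moreover have "dist c z = norm w * norm (of_real \<alpha> + of_real \<beta> * \<epsilon>)"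
    using s(4) unit[OF s(1)] by (simp add: dist_norm norm_mult)
  ultimately show "z \<in> ball c (norm w)"
    using w_nonzero by (simp add: mult_less_cancel_left1)
qed

lemma polygon_halfspaces:
  "polygon \<epsilon> Z c w = (\<Inter>\<eta>\<in>Z. {z. inner (w * (1 + \<epsilon>) * \<eta>) z < top_lev + inner (w * (1 + \<epsilon>) * \<eta>) c})"
  unfolding polygon_def top_lev_def by (auto simp: inner_diff_right algebra_simps)

lemma open_polygon: "open (polygon \<epsilon> Z c w)"
  unfolding polygon_halfspaces using fin by (auto intro: open_halfspace_lt)

lemma convex_polygon: "convex (polygon \<epsilon> Z c w)"
  unfolding polygon_halfspaces by (auto intro: convex_INT convex_halfspace_lt)

lemma center_in_polygon: "c \<in> polygon \<epsilon> Z c w"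
  using top_lev_pos by (simp add: mem_polygon lev_def)

text \<open>On the frontier the largest level is \<open>top_lev\<close>: at most by closure, at
  least because the polygon is open. In the coordinates of \<open>sector\<close> this means
  \<open>\<alpha> + \<beta> = 1\<close>, so the point divides a side.\<close>

lemma frontier_polygon:
  assumes "z \<in> frontier (polygon \<epsilon> Z c w)"
  obtains p q where "p \<in> corners Z c w" "q \<in> corners Z c w" "dist p q = 1" "z \<in> closed_segment p q"
proof -
  have "polygon \<epsilon> Z c w \<subseteq> (\<Inter>\<eta>\<in>Z. {z. inner (w * (1 + \<epsilon>) * \<eta>) z \<le> top_lev + inner (w * (1 + \<epsilon>) * \<eta>)
    c})"
    unfolding polygon_halfspaces by fastforce
  then have "closure (polygon \<epsilon> Z c w) \<subseteq> \<dots>"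
    by (rule closure_minimal) (auto intro: closed_halfspace_le)
  then have le: "lev \<eta> z \<le> top_lev" if "\<eta> \<in> Z" for \<eta>
    using assms that by (fastforce simp: frontier_def lev_def inner_diff_right)
  have "z \<notin> polygon \<epsilon> Z c w"
    using assms open_polygon by (simp add: frontier_def interior_open)
  then obtain \<theta> where \<theta>: "\<theta> \<in> Z" "lev \<theta> z \<ge> top_lev" by (auto simp: mem_polygon not_less)
  obtain \<eta> \<alpha> \<beta> where s: "\<eta> \<in> Z" "\<alpha> \<ge> 0" "\<beta> \<ge> 0"
    "z = c + w * \<eta> * (of_real \<alpha> + of_real \<beta> * \<epsilon>)" "lev \<eta> z = (\<alpha> + \<beta>) * top_lev"
    "\<And>\<theta>. \<theta> \<in> Z \<Longrightarrow> lev \<theta> z \<le> lev \<eta> z"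
    by (rule sector[of z]) blast
  then have "(\<alpha> + \<beta>) * top_lev = 1 * top_lev" using le[OF s(1)] s(5) s(6)[OF \<theta>(1)] \<theta>(2) by linarith
  then have ab: "\<alpha> = 1 - \<beta>" using top_lev_pos by auto
  show ?thesis
  proof (rule that)
    show "c + w * \<eta> \<in> corners Z c w" "c + w * (\<eta> * \<epsilon>) \<in> corners Z c w"
      unfolding corners_def using s(1) mult_in[OF s(1) gen] by blast+
    have "dist (c + w * \<eta>) (c + w * (\<eta> * \<epsilon>)) = norm ((w * (\<epsilon> - 1)) * \<eta>)"
      by (simp add: dist_norm norm_minus_commute algebra_simps)
    also have "\<dots> = 1" using side unit[OF s(1)] by (simp only: norm_mult mult_1)
    finally show "dist (c + w * \<eta>) (c + w * (\<eta> * \<epsilon>)) = 1" .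
    have "z = (1 - \<beta>) *\<^sub>R (c + w * \<eta>) + \<beta> *\<^sub>R (c + w * (\<eta> * \<epsilon>))"
      unfolding s(4) ab by (simp add: scaleR_conv_of_real algebra_simps)
    then show "z \<in> closed_segment (c + w * \<eta>) (c + w * (\<eta> * \<epsilon>))"
      unfolding in_segment using s(2,3) ab by auto
  qed
qed

lemma lev_corner: "\<eta> \<in> Z \<Longrightarrow> \<theta> \<in> Z \<Longrightarrow>
    lev \<theta> (c + w * \<eta>) = (norm w)\<^sup>2 * (Re (\<eta> * cnj \<theta>) + Re (cnj \<epsilon> * (\<eta> * cnj \<theta>)))"
  using lev_eq[of \<eta> \<theta> 1] by (simp add: algebra_simps)

lemma Re_le: "\<eta> \<in> Z \<Longrightarrow> Re \<eta> \<le> 1"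
  using unit complex_Re_le_cmod by metis

lemma lev_corner_le:
  assumes "\<eta> \<in> Z" "\<theta> \<in> Z"
  shows "lev \<theta> (c + w * \<eta>) \<le> top_lev"
proof -
  define \<zeta> where "\<zeta> = \<eta> * cnj \<theta>"
  have \<zeta>: "\<zeta> \<in> Z" using group assms \<zeta>_def by simp
  have "Re \<zeta> + Re (cnj \<epsilon> * \<zeta>) \<le> 1 + Re \<epsilon>"
    using gen_Re[OF \<zeta>] Re_le[OF mult_in[OF cnj_in[OF gen] \<zeta>]] by auto
  then show ?thesis
    unfolding lev_corner[OF assms] \<zeta>_def[symmetric] top_lev_def by (simp add: mult_left_mono)
qed

lemma corners_subset_closure: "corners Z c w \<subseteq> closure (polygon \<epsilon> Z c w)"
proof
  fix p assume "p \<in> corners Z c w"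
  then obtain \<eta> where \<eta>: "\<eta> \<in> Z" "p = c + w * \<eta>" by (auto simp: corners_def)
  \<comment> \<open>The corner is approached along its radius: scaling by \<open>s < 1\<close> about
    the center scales every level by \<open>s\<close>.\<close>
  have "(\<lambda>s. c + of_real s * (w * \<eta>)) ` closure {0..<1} \<subseteq> closure (polygon \<epsilon> Z c w)"
  proof (rule image_closure_subset)
    show "(\<lambda>s. c + of_real s * (w * \<eta>)) ` {0..<1} \<subseteq> closure (polygon \<epsilon> Z c w)"
    proof clarsimp
      fix s :: real assume s: "0 \<le> s" "s < 1"
      have "lev \<theta> (c + of_real s * (w * \<eta>)) < top_lev" if "\<theta> \<in> Z" for \<theta>
      proof -
        have "lev \<theta> (c + of_real s * (w * \<eta>)) = s * lev \<theta> (c + w * \<eta>)"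
          by (simp add: lev_def scaleR_conv_of_real[symmetric])
        also have "\<dots> \<le> s * top_lev" using s lev_corner_le[OF \<eta>(1) that] by (simp add:
          mult_left_mono)
        also have "\<dots> < top_lev" using s top_lev_pos by simp
        finally show ?thesis .
      qed
      then show "c + of_real s * (w * \<eta>) \<in> closure (polygon \<epsilon> Z c w)"
        using closure_subset mem_polygon by blast
    qed
  qed (auto intro!: continuous_intros)
  moreover have "p \<in> (\<lambda>s. c + of_real s * (w * \<eta>)) ` closure {0..<1}"
    using \<eta>(2) by (auto intro!: image_eqI[of _ _ 1])
  ultimately show "p \<in> closure (polygon \<epsilon> Z c w)" by blast
qed

text \<open>A chord of length 1 is a side: its ends differ by a factor with the same real part as
  \<open>\<epsilon>\<close>, hence by \<open>\<epsilon>\<close> or \<open>cnj \<epsilon>\<close>.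
  Along a side the corresponding level is constantly \<open>top_lev\<close>.\<close>

lemma unit_chord_disjoint:
  assumes "p \<in> corners Z c w" "q \<in> corners Z c w" "dist p q = 1" "z \<in> closed_segment p q"
  shows "z \<notin> polygon \<epsilon> Z c w"
proof -
  have side_case: "z \<notin> polygon \<epsilon> Z c w"
    if "\<eta> \<in> Z" "z \<in> closed_segment (c + w * \<eta>) (c + w * (\<epsilon> * \<eta>))" for \<eta>
  proof -
    have "lev \<eta> (c + w * \<eta>) = top_lev" "lev \<eta> (c + w * (\<epsilon> * \<eta>)) = top_lev"
      using mult_cnj_unit[OF that(1)] mult_cnj_unit[OF gen]
      by (simp_all add: lev_corner that(1) mult_in gen top_lev_def mult.assoc)
        (use gen_square in \<open>simp_all add: mult.assoc[symmetric] cnj_mult_unit gen power2_eq_square\<close>)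
    moreover from that obtain u where "z = (1 - u) *\<^sub>R (c + w * \<eta>) + u *\<^sub>R (c + w * (\<epsilon> * \<eta>))"
      by (auto simp: in_segment)
    then have "z - c = (1 - u) *\<^sub>R (c + w * \<eta> - c) + u *\<^sub>R (c + w * (\<epsilon> * \<eta>) - c)"
      by (simp add: algebra_simps)
    then have "lev \<eta> z = (1 - u) * lev \<eta> (c + w * \<eta>) + u * lev \<eta> (c + w * (\<epsilon> * \<eta>))"
      unfolding lev_def by (simp only: inner_add_right inner_scaleR_right)
    ultimately have "lev \<eta> z = top_lev" by (simp add: algebra_simps)
    then show ?thesis using that(1) unfolding mem_polygon by force
  qed
  obtain \<eta> \<theta> where pq: "\<eta> \<in> Z" "p = c + w * \<eta>" "\<theta> \<in> Z" "q = c + w * \<theta>"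
    using assms by (auto simp: corners_def)
  define \<zeta> where "\<zeta> = \<eta> * cnj \<theta>"
  have \<zeta>: "\<zeta> \<in> Z" "\<eta> = \<zeta> * \<theta>" "\<theta> = cnj \<zeta> * \<eta>"
    using pq group mult_cnj_unit[OF pq(1)] mult_cnj_unit[OF pq(3)]
    by (auto simp: \<zeta>_def ac_simps)
  have nrm: "(norm (\<xi> - 1))\<^sup>2 = 2 - 2 * Re \<xi>" if "\<xi> \<in> Z" for \<xi>
  proof -
    have "(Re \<xi>)\<^sup>2 + (Im \<xi>)\<^sup>2 = 1" using unit[OF that] by (simp add: cmod_def)
    then show ?thesis unfolding cmod_power2 by (simp add: power2_eq_square algebra_simps)
  qed
  have "dist p q = norm ((w * (\<zeta> - 1)) * \<theta>)"
    unfolding pq dist_norm using \<zeta>(2) by (simp add: algebra_simps)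
  then have "norm w * norm (\<zeta> - 1) = norm w * norm (\<epsilon> - 1)"
    using assms(3) side unit[OF pq(3)] by (simp add: norm_mult)
  then have "Re \<zeta> = Re \<epsilon>"
    using w_nonzero nrm[OF \<zeta>(1)] nrm[OF gen] by simp
  then have "\<zeta> = \<epsilon> \<or> \<zeta> = cnj \<epsilon>" using gen_Re[OF \<zeta>(1)] gen_Re_bounds by auto
  then show ?thesis
  proof
    assume "\<zeta> = \<epsilon>"
    then show ?thesis using side_case[of \<theta>] pq \<zeta>(2) assms(4) by (simp add: closed_segment_commute)
  next
    assume "\<zeta> = cnj \<epsilon>"
    then show ?thesis using side_case[of \<eta>] pq \<zeta>(3) assms(4) by simp
  qed
qed

lemma sum_roots: "\<Sum>Z = 0"
proof -
  have "bij_betw (\<lambda>\<eta>. \<epsilon> * \<eta>) Z Z"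
    using mult_in[OF gen] mult_in[OF cnj_in[OF gen]] mult_cnj_unit[OF gen]
    by (intro bij_betw_byWitness[where f' = "\<lambda>\<eta>. cnj \<epsilon> * \<eta>"]) (auto simp: mult.assoc[symmetric]
      cnj_mult_unit gen)
  then have "\<Sum>Z = \<epsilon> * \<Sum>Z"
    using sum.reindex_bij_betw[of "\<lambda>\<eta>. \<epsilon> * \<eta>" Z Z "\<lambda>x. x"] by (simp add: sum_distrib_left)
  then show ?thesis using gen_Im by (metis complex_is_Real_iff mult_cancel_right1 Reals_1)
qed

text \<open>The parallel axis theorem: the cross terms cancel because the corners have centroid
  \<open>c\<close>, by \<open>sum_roots\<close>. It turns statements about all corners into
  statements about the center.\<close>

lemma sum_dist_corners:
  "(\<Sum>\<eta>\<in>Z. (dist x (c + w * \<eta>))\<^sup>2) = card Z * ((dist x c)\<^sup>2 + (norm w)\<^sup>2)"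
proof -
  have "(\<Sum>\<eta>\<in>Z. (dist x (c + w * \<eta>))\<^sup>2) = (\<Sum>\<eta>\<in>Z. ((dist x c)\<^sup>2 + (norm w)\<^sup>2) - 2 * inner (x - c) (w *
    \<eta>))"
  proof (rule sum.cong[OF refl])
    fix \<eta> assume \<eta>: "\<eta> \<in> Z"
    have "x - (c + w * \<eta>) = (x - c) - w * \<eta>" by simp
    then have "(dist x (c + w * \<eta>))\<^sup>2 = (norm (x - c))\<^sup>2 + (norm (w * \<eta>))\<^sup>2 - 2 * inner (x - c) (w *
      \<eta>)"
      unfolding dist_norm by (simp only: power2_norm_eq_inner inner_diff_left inner_diff_right
        inner_commute)
        (simp add: inner_commute)
    then show "(dist x (c + w * \<eta>))\<^sup>2 = ((dist x c)\<^sup>2 + (norm w)\<^sup>2) - 2 * inner (x - c) (w * \<eta>)"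
      using unit[OF \<eta>] by (simp add: dist_norm norm_mult)
  qed
  also have "\<dots> = card Z * ((dist x c)\<^sup>2 + (norm w)\<^sup>2) - 2 * inner (x - c) (w * \<Sum>Z)"
    by (simp add: sum_subtractf sum_distrib_left inner_sum_right)
  finally show ?thesis using sum_roots by simp
qed

lemma card_pos: "card Z > 0"
  using fin one_in by (auto simp: card_gt_0_iff)

lemma dist_center_ge:
  assumes "\<And>\<eta>. \<eta> \<in> Z \<Longrightarrow> 1 \<le> dist x (c + w * \<eta>)"
  shows "1 \<le> (dist x c)\<^sup>2 + (norm w)\<^sup>2"
proof -
  have "(\<Sum>\<eta>\<in>Z. 1) \<le> (\<Sum>\<eta>\<in>Z. (dist x (c + w * \<eta>))\<^sup>2)"
    using assms by (intro sum_mono) (simp add: one_le_power)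
  then show ?thesis using card_pos unfolding sum_dist_corners by simp
qed

lemma closure_subset_cball: "closure (polygon \<epsilon> Z c w) \<subseteq> cball c (norm w)"
  using polygon_subset_ball ball_subset_cball by (intro closure_minimal) (blast, simp)

lemma dist_center_le:
  assumes "closure (polygon \<epsilon> Z c w) \<subseteq> cball x R"
  shows "(dist x c)\<^sup>2 + (norm w)\<^sup>2 \<le> R\<^sup>2"
proof -
  have "(\<Sum>\<eta>\<in>Z. (dist x (c + w * \<eta>))\<^sup>2) \<le> (\<Sum>\<eta>\<in>Z. R\<^sup>2)"
  proof (rule sum_mono)
    fix \<eta> assume "\<eta> \<in> Z"
    then have "c + w * \<eta> \<in> cball x R"
      using corners_subset_closure assms unfolding corners_def by blast
    then show "(dist x (c + w * \<eta>))\<^sup>2 \<le> R\<^sup>2" by (intro power_mono) (simp_all only: mem_cball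
      zero_le_dist)
  qed
  then show ?thesis using card_pos unfolding sum_dist_corners by simp
qed

text \<open>If \<open>x\<close> has distance at least 1 from every corner, averaging bounds its
  squared distance from the center below by \<open>1 - (norm w)\<^sup>2\<close>, which is at least
  \<open>(norm w)\<^sup>2\<close> here. This serves triangles and squares; the hexagon has
  circumradius 1 and needs its own argument.\<close>

lemma small_circle_empty:
  assumes "\<And>x y. x \<in> V \<Longrightarrow> y \<in> V \<Longrightarrow> x \<noteq> y \<Longrightarrow> 1 \<le> dist x y" "corners Z c w \<subseteq> V"
    and "(norm w)\<^sup>2 \<le> 1 / 2" "x \<in> V"
  shows "norm w \<le> dist x c"
proof (cases "x \<in> corners Z c w")
  case True
  then show ?thesis using unit by (auto simp: corners_def dist_norm norm_mult)
next
  case False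
  then have "1 \<le> (dist x c)\<^sup>2 + (norm w)\<^sup>2"
    using assms(1)[OF assms(4)] assms(2) unfolding corners_def by (intro dist_center_ge) blast
  then have "(norm w)\<^sup>2 \<le> (dist x c)\<^sup>2" using assms(3) by linarith
  then show ?thesis by (rule power2_le_imp_le) simp
qed

end

text \<open>Each description places the corners of the other in its circumdisc. Averaging in both
  directions compares the two squared radii both ways and leaves no room for a distance between the
  centers.\<close>

lemma polygon_center_unique:
  assumes "unit_polygon \<epsilon> Z w" "unit_polygon \<epsilon>' Z' w'"
  and "polygon \<epsilon> Z c w = polygon \<epsilon>' Z' c' w'"
  shows "c = c'"
proof -
  interpret f: unit_polygon \<epsilon> Z c w by fact
  interpret g: unit_polygon \<epsilon>' Z' c' w' by fact
  have "(dist c' c)\<^sup>2 + (norm w)\<^sup>2 \<le> (norm w')\<^sup>2" "(dist c c')\<^sup>2 + (norm w')\<^sup>2 \<le> (norm w)\<^sup>2"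
    using f.dist_center_le g.dist_center_le f.closure_subset_cball g.closure_subset_cball assms(3)
      by simp_all
  then have "(dist c c')\<^sup>2 \<le> 0" unfolding dist_commute[of c' c] by linarith
  then show ?thesis by simp
qed

text \<open>Conditions under which the open polygon is a face: separation excludes proper crossings
  of unit edges, and the empty circumcircle keeps vertices out of the interior.\<close>

locale unit_tile = unit_polygon +
  fixes V :: "complex set"
  assumes separated: "\<And>x y. x \<in> V \<Longrightarrow> y \<in> V \<Longrightarrow> x \<noteq> y \<Longrightarrow> 1 \<le> dist x y"
  and corners_V: "corners Z c w \<subseteq> V"
  and empty_circle: "\<And>x. x \<in> V \<Longrightarrow> norm w \<le> dist x c"
begin

lemma drawing_eq: "drawing (unit_distance_graph V) = V \<union> {z. \<exists>x\<in>V. \<exists>y\<in>V. dist x y = 1 \<and> z \<in>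
  closed_segment x y}"
  unfolding drawing_def unit_distance_graph_def by (auto simp: segment_convex_hull)

lemma vertex_notin: "x \<in> V \<Longrightarrow> x \<notin> polygon \<epsilon> Z c w"
  using empty_circle polygon_subset_ball by (fastforce simp: dist_commute)

text \<open>A unit edge entering the open polygon crosses a side, which is possible only at a corner.\<close>

lemma edge_exits_at_corner:
  assumes xy: "x \<in> V" "y \<in> V" "dist x y = 1" and z: "z \<in> closed_segment x y" "z \<in> polygon \<epsilon> Z c w"
  shows "x \<in> corners Z c w"
proof -
  have "closed_segment x z \<inter> frontier (polygon \<epsilon> Z c w) \<noteq> {}"
    using vertex_notin[OF xy(1)] z(2) by (intro connected_Int_frontier) auto
  then obtain f where f: "f \<in> closed_segment x z" "f \<in> frontier (polygon \<epsilon> Z c w)" by blast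
  obtain p q where pq: "p \<in> corners Z c w" "q \<in> corners Z c w" "dist p q = 1" "f \<in> closed_segment p
    q"
    using frontier_polygon[OF f(2)] by metis
  have "closed_segment x z \<subseteq> closed_segment x y"
    using z(1) by (simp add: subset_closed_segment)
  then have "{x, y} = {p, q} \<or> f \<in> {x, y} \<inter> {p, q}"
    using separated corners_V pq xy f(1) by (intro unit_segments_cross) auto
  moreover have "{x, y} \<noteq> {p, q}"
    using unit_chord_disjoint[of x y z] pq(1-3) z xy(3) by (auto simp: doubleton_eq_iff
      dist_commute)
  moreover have "f \<noteq> y"
  proof
    assume "f = y"
    then have "dist x z = dist x y + dist y z" "dist x y = dist x z + dist z y"
      using f(1) z(1) by (auto simp: between_mem_segment[symmetric] between)
    then have "z = y" by (simp add: dist_commute)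
    then show False using z(2) vertex_notin[OF xy(2)] by simp
  qed
  ultimately show ?thesis using pq by auto
qed

text \<open>An edge meeting the polygon would have corners at both ends, by
  \<open>edge_exits_at_corner\<close> in both directions, and would thus be a unit chord.\<close>

lemma polygon_disjoint_drawing: "polygon \<epsilon> Z c w \<inter> drawing (unit_distance_graph V) = {}"
proof -
  have False if "x \<in> V" "y \<in> V" "dist x y = 1" "z \<in> closed_segment x y" "z \<in> polygon \<epsilon> Z c w" for x
    y z
  proof -
    have "x \<in> corners Z c w" using edge_exits_at_corner[of x y z] that by simp
    moreover have "y \<in> corners Z c w"
      using edge_exits_at_corner[of y x z] that by (simp add: dist_commute[of y x]
        closed_segment_commute[of y x])
    ultimately show False using unit_chord_disjoint[of x y z] that by simp
  qed
  then show ?thesis unfolding drawing_eq using vertex_notin by blast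
qed

lemma frontier_subset_drawing: "frontier (polygon \<epsilon> Z c w) \<subseteq> drawing (unit_distance_graph V)"
proof
  fix z assume "z \<in> frontier (polygon \<epsilon> Z c w)"
  then obtain p q where "p \<in> corners Z c w" "q \<in> corners Z c w" "dist p q = 1" "z \<in> closed_segment p
    q"
    by (rule frontier_polygon)
  then show "z \<in> drawing (unit_distance_graph V)"
    unfolding drawing_eq using corners_V by auto
qed

text \<open>A connected set that contains the polygon and reaches beyond it meets the frontier,
  which belongs to the drawing.\<close>

lemma polygon_is_face: "polygon \<epsilon> Z c w \<in> faces (unit_distance_graph V)"
  unfolding faces_def in_components_maximal
proof (intro conjI allI impI)
  show "polygon \<epsilon> Z c w \<noteq> {}" using center_in_polygon by blast
  show "polygon \<epsilon> Z c w \<subseteq> - drawing (unit_distance_graph V)" using polygon_disjoint_drawing by blast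
  show "connected (polygon \<epsilon> Z c w)" using convex_polygon convex_connected by blast
  fix D assume "D \<noteq> {} \<and> polygon \<epsilon> Z c w \<subseteq> D \<and> D \<subseteq> - drawing (unit_distance_graph V) \<and> connected D"
  then show "D = polygon \<epsilon> Z c w"
    using connected_Int_frontier[of D "polygon \<epsilon> Z c w"] frontier_subset_drawing center_in_polygon
      by blast
qed

lemma side_subset_frontier:
  assumes "p \<in> corners Z c w" "q \<in> corners Z c w" "dist p q = 1"
  shows "convex hull {p, q} \<subseteq> frontier (polygon \<epsilon> Z c w)"
proof -
  have "convex hull {p, q} \<subseteq> closure (polygon \<epsilon> Z c w)"
    using assms corners_subset_closure convex_closure[OF convex_polygon] by (intro hull_minimal)
      auto
  moreover have "convex hull {p, q} \<inter> polygon \<epsilon> Z c w = {}"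
    using unit_chord_disjoint[OF assms] by (auto simp: segment_convex_hull)
  ultimately show ?thesis using open_polygon by (auto simp: frontier_def interior_open)
qed

end

lemma unit_tile_dual_edge:
  assumes "unit_tile \<epsilon> Z c w V" "unit_tile \<epsilon>' Z' c' w' V" "c \<noteq> c'"
  and "p \<in> corners Z c w \<inter> corners Z' c' w'" "q \<in> corners Z c w \<inter> corners Z' c' w'" "dist p q = 1"
  shows "{polygon \<epsilon> Z c w, polygon \<epsilon>' Z' c' w'} \<in> edges (planar_dual (unit_distance_graph V))"
proof -
  interpret f: unit_tile \<epsilon> Z c w V by fact
  interpret g: unit_tile \<epsilon>' Z' c' w' V by fact
  have "polygon \<epsilon> Z c w \<noteq> polygon \<epsilon>' Z' c' w'"
    using polygon_center_unique f.unit_polygon_axioms g.unit_polygon_axioms assms(3) by metis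
  moreover have "{p, q} \<in> edges (unit_distance_graph V)"
    using assms(4-6) f.corners_V unfolding unit_distance_graph_def by auto
  moreover have "convex hull {p, q} \<subseteq> frontier (polygon \<epsilon> Z c w) \<inter> frontier (polygon \<epsilon>' Z' c' w')"
    using f.side_subset_frontier g.side_subset_frontier assms(4-6) by auto
  ultimately show ?thesis
    unfolding planar_dual_def using f.polygon_is_face g.polygon_is_face by simp blast
qed

locale unit_tiling =
  fixes V :: "complex set" and rot ctr rad :: "'i \<Rightarrow> complex" and Zs :: "'i \<Rightarrow> complex set"
  assumes tile: "\<And>i. unit_tile (rot i) (Zs i) (ctr i) (rad i) V" and inj_ctr: "inj ctr"
begin

definition face :: "'i \<Rightarrow> complex set" where
  "face i = polygon (rot i) (Zs i) (ctr i) (rad i)"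

lemma inj_face: "inj face"
  using polygon_center_unique tile[THEN unit_tile.axioms(1)] injD[OF inj_ctr]
  unfolding inj_def face_def by metis

lemma face_in_verts: "face i \<in> verts (planar_dual (unit_distance_graph V))"
  unfolding planar_dual_def face_def using unit_tile.polygon_is_face[OF tile] by simp

lemma face_edge:
  assumes "i \<noteq> j" "{p, q} \<subseteq> corners (Zs i) (ctr i) (rad i) \<inter> corners (Zs j) (ctr j) (rad j)" "dist p
    q = 1"
  shows "face ` {i, j} \<in> edges (planar_dual (unit_distance_graph V))"
  using unit_tile_dual_edge[OF tile[of i] tile[of j]] assms injD[OF inj_ctr] by (auto simp:
    face_def)

end

subsection \<open>The rhombille tiling\<close>

definition omega :: complex ("\<omega>") where "\<omega> = cis (pi / 3)"

lemma Re_omega [simp]: "Re \<omega> = 1 / 2" and Im_omega [simp]: "Im \<omega> = sqrt 3 / 2"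
  by (simp_all add: omega_def cos_60 sin_60)

lemma sqrt3_mult [simp]: "sqrt 3 * sqrt 3 = 3" "sqrt 3 * (sqrt 3 * a) = 3 * a" for a :: real
  by (simp_all flip: mult.assoc)

lemma omega_square: "\<omega> * \<omega> = \<omega> - 1" "\<omega> * (\<omega> * a) = \<omega> * a - a"
proof -
  show "\<omega> * \<omega> = \<omega> - 1" by (simp add: complex_eq_iff)
  then show "\<omega> * (\<omega> * a) = \<omega> * a - a" by (simp add: mult.assoc[symmetric] left_diff_distrib)
qed

lemma cnj_omega: "cnj \<omega> = 1 - \<omega>"
  by (simp add: complex_eq_iff)

lemma norm_omega [simp]: "norm \<omega> = 1"
  by (simp add: omega_def)

text \<open>The powers of \<open>\<omega>\<close>, reduced by
  \<open>\<omega> * \<omega> = \<omega> - 1\<close> so that products can be compared by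
  simplification.\<close>

definition hexagon_roots :: "complex set" where
  "hexagon_roots = {1, \<omega>, \<omega> - 1, -1, -\<omega>, 1 - \<omega>}"

definition square_roots :: "complex set" where
  "square_roots = {1, \<i>, -1, -\<i>}"

definition triangle_roots :: "complex set" where
  "triangle_roots = {1, \<omega> - 1, -\<omega>}"

lemma norm_hexagon_roots: "\<eta> \<in> hexagon_roots \<Longrightarrow> norm \<eta> = 1"
  by (auto simp: hexagon_roots_def cmod_def power2_eq_square)

lemma norm_triangle_roots: "\<eta> \<in> triangle_roots \<Longrightarrow> norm \<eta> = 1"
  by (rule norm_hexagon_roots) (auto simp: triangle_roots_def hexagon_roots_def)

text \<open>In this lemma and the next two, the prescribed norm of \<open>w\<close> is the
  circumradius of the hexagon, square or triangle with side 1.\<close>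

lemma unit_polygon_hexagon: "norm w = 1 \<Longrightarrow> unit_polygon \<omega> hexagon_roots w"
proof
  have "\<forall>\<eta>\<in>hexagon_roots. \<forall>\<theta>\<in>hexagon_roots. \<eta> * cnj \<theta> \<in> hexagon_roots"
    unfolding hexagon_roots_def by (simp add: cnj_omega algebra_simps omega_square)
  then show "\<eta> * cnj \<theta> \<in> hexagon_roots" if "\<eta> \<in> hexagon_roots" "\<theta> \<in> hexagon_roots" for \<eta> \<theta>
    using that by blast
  show "norm w = 1 \<Longrightarrow> norm (w * (\<omega> - 1)) = 1"
    using norm_hexagon_roots[of "\<omega> - 1"] by (simp add: norm_mult hexagon_roots_def)
qed (auto simp: norm_hexagon_roots, auto simp: hexagon_roots_def complex_eq_iff)

lemma unit_polygon_square: "(norm w)\<^sup>2 = 1 / 2 \<Longrightarrow> unit_polygon \<i> square_roots w"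
proof
  assume "(norm w)\<^sup>2 = 1 / 2"
  then have "(norm (w * (\<i> - 1)))\<^sup>2 = 1" by (simp add: norm_mult power_mult_distrib cmod_power2)
  then show "norm (w * (\<i> - 1)) = 1" by (simp add: power2_eq_1_iff) (metis norm_ge_zero norm_mult
    neg_0_le_iff_le not_one_le_zero)
qed (auto simp: square_roots_def)

lemma unit_polygon_triangle: "(norm w)\<^sup>2 = 1 / 3 \<Longrightarrow> unit_polygon (\<omega> - 1) triangle_roots w"
proof
  have "\<forall>\<eta>\<in>triangle_roots. \<forall>\<theta>\<in>triangle_roots. \<eta> * cnj \<theta> \<in> triangle_roots"
    unfolding triangle_roots_def by (simp add: cnj_omega algebra_simps omega_square)
  then show "\<eta> * cnj \<theta> \<in> triangle_roots" if "\<eta> \<in> triangle_roots" "\<theta> \<in> triangle_roots" for \<eta> \<theta>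
    using that by blast
  assume "(norm w)\<^sup>2 = 1 / 3"
  then have "(norm (w * (\<omega> - 1 - 1)))\<^sup>2 = 1"
    by (simp add: norm_mult power_mult_distrib cmod_power2) (simp add: power2_eq_square)
  then show "norm (w * (\<omega> - 1 - 1)) = 1" by (simp add: power2_eq_1_iff) (metis norm_ge_zero
    norm_mult neg_0_le_iff_le not_one_le_zero)
qed (auto simp: norm_triangle_roots, auto simp: triangle_roots_def complex_eq_iff)

section \<open>Eisenstein integers and the tiles of the trihexagonal tiling\<close>

definition eisenstein :: "int \<Rightarrow> int \<Rightarrow> complex" where
  "eisenstein a b = of_int a + of_int b * \<omega>"

lemma eisenstein_diff: "eisenstein a b - eisenstein a' b' = eisenstein (a - a') (b - b')"
  by (simp add: eisenstein_def algebra_simps)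

lemma norm_eisenstein: "(norm (eisenstein a b))\<^sup>2 = of_int (a\<^sup>2 + a * b + b\<^sup>2)"
  by (simp add: eisenstein_def cmod_power2) (simp add: power2_eq_square algebra_simps)

lemma norm_eisenstein_eq_1: "norm (eisenstein a b) = 1 \<longleftrightarrow> a\<^sup>2 + a * b + b\<^sup>2 = 1"
proof -
  have "norm (eisenstein a b) = 1 \<longleftrightarrow> (norm (eisenstein a b))\<^sup>2 = 1"
    by (simp add: power2_eq_1_iff) (smt (verit) norm_ge_zero)
  then show ?thesis unfolding norm_eisenstein by linarith
qed

text \<open>The squared norm is a positive definite form with integer values, as completing the
  square shows.\<close>

lemma norm_eisenstein_ge_1:
  assumes "(a, b) \<noteq> (0, 0)"
  shows "1 \<le> norm (eisenstein a b)"
proof -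
  have "4 * (a\<^sup>2 + a * b + b\<^sup>2) = (2 * a + b)\<^sup>2 + 3 * b\<^sup>2"
    by (simp add: power2_eq_square algebra_simps)
  moreover have "\<dots> > 0"
    using assms by (cases "b = 0") (auto intro: add_nonneg_pos)
  ultimately have "0 < 4 * (a\<^sup>2 + a * b + b\<^sup>2)" by simp
  then have "1 \<le> a\<^sup>2 + a * b + b\<^sup>2" by (simp add: int_one_le_iff_zero_less)
  then have "1 \<le> (norm (eisenstein a b))\<^sup>2" unfolding norm_eisenstein by (simp only:
    of_int_1_le_iff)
  then show ?thesis by (intro power2_le_imp_le[of 1]) simp_all
qed

lemma eisenstein_eq_iff: "eisenstein a b = eisenstein a' b' \<longleftrightarrow> a = a' \<and> b = b'"
  by (auto simp: eisenstein_def complex_eq_iff)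

text \<open>The lines on which one coordinate is a constant even integer cut the plane into cells, each consisting of a hexagon and
  the triangles \<open>Low\<close> and \<open>Up\<close> at two opposite corners.\<close>

datatype trihex_tile = Hex int int | Low int int | Up int int

primrec trihex_rot where
  "trihex_rot (Hex i j) = \<omega>" | "trihex_rot (Low i j) = \<omega> - 1" | "trihex_rot (Up i j) = \<omega> - 1"

primrec trihex_roots where
  "trihex_roots (Hex i j) = hexagon_roots"
| "trihex_roots (Low i j) = triangle_roots"
| "trihex_roots (Up i j) = triangle_roots"

text \<open>\<open>(1 + \<omega>) / 3\<close> is the centroid of the triangle with corners 0, 1 and
  \<open>\<omega>\<close>. The radius vector of a triangle leads from its centroid to the corner it
  shares with its cell.\<close>

primrec trihex_ctr where
  "trihex_ctr (Hex i j) = eisenstein (2 * i + 1) (2 * j + 1)"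
| "trihex_ctr (Low i j) = eisenstein (2 * i) (2 * j) + (1 + \<omega>) / 3"
| "trihex_ctr (Up i j) = eisenstein (2 * i + 2) (2 * j + 2) - (1 + \<omega>) / 3"

primrec trihex_rad where
  "trihex_rad (Hex i j) = 1"
| "trihex_rad (Low i j) = -(1 + \<omega>) / 3"
| "trihex_rad (Up i j) = (1 + \<omega>) / 3"

abbreviation "trihex_corners u \<equiv> corners (trihex_roots u) (trihex_ctr u) (trihex_rad u)"

lemma trihex_corners:
  "trihex_corners (Hex i j) = {eisenstein (2*i+2) (2*j+1), eisenstein (2*i+1) (2*j+2), eisenstein
    (2*i) (2*j+2),
     eisenstein (2*i) (2*j+1), eisenstein (2*i+1) (2*j), eisenstein (2*i+2) (2*j)}"
  "trihex_corners (Low i j) = {eisenstein (2*i) (2*j), eisenstein (2*i+1) (2*j), eisenstein (2*i)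
    (2*j+1)}"
  "trihex_corners (Up i j) = {eisenstein (2*i+2) (2*j+2), eisenstein (2*i+1) (2*j+2), eisenstein
    (2*i+2) (2*j+1)}"
proof -
  show "trihex_corners (Hex i j) = {eisenstein (2*i+2) (2*j+1), eisenstein (2*i+1) (2*j+2),
    eisenstein (2*i) (2*j+2),
     eisenstein (2*i) (2*j+1), eisenstein (2*i+1) (2*j), eisenstein (2*i+2) (2*j)}"
    unfolding corners_def trihex_roots.simps trihex_ctr.simps trihex_rad.simps hexagon_roots_def
      image_insert image_empty
    by (intro arg_cong2[where f = insert] refl; simp add: eisenstein_def algebra_simps)
  show "trihex_corners (Low i j) = {eisenstein (2*i) (2*j), eisenstein (2*i+1) (2*j), eisenstein
    (2*i) (2*j+1)}"
    unfolding corners_def trihex_roots.simps trihex_ctr.simps trihex_rad.simps triangle_roots_def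
      image_insert image_empty
    by (intro arg_cong2[where f = insert] refl; simp add: eisenstein_def field_simps omega_square)
  show "trihex_corners (Up i j) = {eisenstein (2*i+2) (2*j+2), eisenstein (2*i+1) (2*j+2),
    eisenstein (2*i+2) (2*j+1)}"
    unfolding corners_def trihex_roots.simps trihex_ctr.simps trihex_rad.simps triangle_roots_def
      image_insert image_empty
    by (intro arg_cong2[where f = insert] refl; simp add: eisenstein_def field_simps omega_square)
qed

definition trihex_points :: "complex set" where
  "trihex_points = {eisenstein a b | a b. \<not> (odd a \<and> odd b)}"

lemma eisenstein_in_trihex_points: "eisenstein a b \<in> trihex_points \<longleftrightarrow> \<not> (odd a \<and> odd b)"
  by (auto simp: trihex_points_def eisenstein_eq_iff)

lemma trihexagonal_eq: "trihexagonal_lattice = unit_distance_graph trihex_points"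
  by (simp add: trihexagonal_lattice_def trihex_points_def eisenstein_def omega_def)

lemma norm_third: "(norm ((1 + \<omega>) / 3))\<^sup>2 = 1 / 3"
  by (simp add: cmod_power2 power_divide Re_divide Im_divide)

lemma trihex_tiling: "unit_tiling trihex_points trihex_rot trihex_ctr trihex_rad trihex_roots"
proof (rule unit_tiling.intro)
  have sep: "1 \<le> dist x y" if "x \<in> trihex_points" "y \<in> trihex_points" "x \<noteq> y" for x y
    using that unfolding trihex_points_def dist_norm by (auto simp: eisenstein_diff intro!:
      norm_eisenstein_ge_1)
  have cV: "trihex_corners u \<subseteq> trihex_points" for u
    by (cases u; simp only: trihex_corners) (auto simp: eisenstein_in_trihex_points)
  show "unit_tile (trihex_rot u) (trihex_roots u) (trihex_ctr u) (trihex_rad u) trihex_points" for u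
  proof (cases u)
    case (Hex i j)
    interpret unit_polygon "trihex_rot u" "trihex_roots u" "trihex_ctr u" "trihex_rad u"
      using Hex by (simp add: unit_polygon_hexagon)
    show ?thesis
    proof
      \<comment> \<open>The center has two odd coordinates, hence differs from the lattice point
        \<open>x\<close> by a nonzero Eisenstein integer.\<close>
      fix x assume "x \<in> trihex_points"
      then show "norm (trihex_rad u) \<le> dist x (trihex_ctr u)"
        using Hex unfolding trihex_points_def dist_norm by (auto simp: eisenstein_diff intro!:
          norm_eisenstein_ge_1)
    qed (use sep cV in auto)
  next
    case (Low i j)
    then have w: "(norm (trihex_rad u))\<^sup>2 = 1 / 3"
      using norm_third norm_minus_cancel[of "(1 + \<omega>) / 3"] by (simp add: minus_divide_left)
    then interpret unit_polygon "trihex_rot u" "trihex_roots u" "trihex_ctr u" "trihex_rad u"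
      using Low by (simp add: unit_polygon_triangle del: trihex_rad.simps)
    show ?thesis
      using small_circle_empty[OF sep cV] w by unfold_locales (use sep cV in auto)
  next
    case (Up i j)
    then have w: "(norm (trihex_rad u))\<^sup>2 = 1 / 3"
      using norm_third by simp
    then interpret unit_polygon "trihex_rot u" "trihex_roots u" "trihex_ctr u" "trihex_rad u"
      using Up by (simp add: unit_polygon_triangle del: trihex_rad.simps)
    show ?thesis
      using small_circle_empty[OF sep cV] w by unfold_locales (use sep cV in auto)
  qed
  \<comment> \<open>Tripling clears the denominators; the residues 3, 1 and 5 modulo 6 then tell the
    kinds of tiles apart.\<close>
  have 3: "3 * trihex_ctr u = (case u of Hex i j \<Rightarrow> eisenstein (6*i+3) (6*j+3) | Low i j \<Rightarrow> eisenstein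
    (6*i+1) (6*j+1)
      | Up i j \<Rightarrow> eisenstein (6*i+5) (6*j+5))" for u
    by (cases u) (auto simp: eisenstein_def field_simps)
  show "inj trihex_ctr"
  proof (rule injI)
    fix u v assume "trihex_ctr u = trihex_ctr v"
    then have "3 * trihex_ctr u = 3 * trihex_ctr v" by simp
    then show "u = v"
      unfolding 3 by (cases u; cases v; simp add: eisenstein_eq_iff; presburger)
  qed
qed

lemma trihexagonal_dual_obstruction:
  fixes r :: int
  assumes "r > 0"
  shows "\<exists>H. finite_subgraph H (planar_dual trihexagonal_lattice) \<and>
    (\<forall>t\<ge>0. \<not> total_threshold_colorable r t H)"
proof -
  interpret unit_tiling trihex_points trihex_rot trihex_ctr trihex_rad trihex_roots by (rule
    trihex_tiling)
  \<comment> \<open>\<open>Ev\<close> and \<open>Eh\<close> are the dual edges crossing the grid lines, \<open>En\<close> those inside a cell.\<close>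
  define Ev where "Ev i j = {{Hex (i - 1) j, Low i j}, {Up (i - 1) j, Hex i j}}" for i j
  define Eh where "Eh i j = {{Hex i (j - 1), Low i j}, {Up i (j - 1), Hex i j}}" for i j
  define En where "En i j = {{Hex i j, Low i j}, {Hex i j, Up i j}}" for i j
  define E where "E = (\<Union>i j. Ev i j \<union> Eh i j \<union> En i j)"
  define F where "F = (\<Union>i j. (if spiral_v i j then Ev i j else {}) \<union> (if spiral_h i j then Eh i j
    else {}))"
  define B where "B = (\<Union>i\<in>{-r - 3..r + 3}. \<Union>j\<in>{-r - 3..r + 3}. {Hex i j, Low i j, Up i j})"
  have F: "{Hex (i - 1) j, Low i j} \<in> F \<longleftrightarrow> spiral_v i j" "{Up (i - 1) j, Hex i j} \<in> F \<longleftrightarrow> spiral_v i j"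
    "{Hex i (j - 1), Low i j} \<in> F \<longleftrightarrow> spiral_h i j" "{Up i (j - 1), Hex i j} \<in> F \<longleftrightarrow> spiral_h i j"
    "{Hex i j, Low i j} \<notin> F" "{Hex i j, Up i j} \<notin> F" for i j
    unfolding F_def Ev_def Eh_def by (auto simp: doubleton_eq_iff split: if_splits)
  have edge: "face ` {u, v} \<in> edges (planar_dual trihexagonal_lattice)"
    if "u \<noteq> v" "{eisenstein a b, eisenstein a' b'} \<subseteq> trihex_corners u \<inter> trihex_corners v"
      "(a - a')\<^sup>2 + (a - a') * (b - b') + (b - b')\<^sup>2 = 1" for u v a b a' b'
    unfolding trihexagonal_eq using that by (intro face_edge) (auto simp: dist_norm eisenstein_diff
      norm_eisenstein_eq_1)
  show ?thesis
  proof (rule not_colorable_subgraph[where \<phi> = face and E = E and B = B and F = F])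
    show "inj face" by (rule inj_face)
    show "face u \<in> verts (planar_dual trihexagonal_lattice)" for u
      unfolding trihexagonal_eq by (rule face_in_verts)
    have "face ` {Hex (i - 1) j, Low i j} \<in> edges (planar_dual trihexagonal_lattice)" for i j
      by (rule edge[of _ _ "2*i" "2*j" "2*i" "2*j+1"]; (simp only: trihex_corners)?) (simp_all add:
        eisenstein_eq_iff)
    moreover have "face ` {Up (i - 1) j, Hex i j} \<in> edges (planar_dual trihexagonal_lattice)" for i
      j
      by (rule edge[of _ _ "2*i" "2*j+1" "2*i" "2*j+2"]; (simp only: trihex_corners)?) (simp_all
        add: eisenstein_eq_iff)
    moreover have "face ` {Hex i (j - 1), Low i j} \<in> edges (planar_dual trihexagonal_lattice)" for i
      j
      by (rule edge[of _ _ "2*i" "2*j" "2*i+1" "2*j"]; (simp only: trihex_corners)?) (simp_all add: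
        eisenstein_eq_iff)
    moreover have "face ` {Up i (j - 1), Hex i j} \<in> edges (planar_dual trihexagonal_lattice)" for i
      j
      by (rule edge[of _ _ "2*i+1" "2*j" "2*i+2" "2*j"]; (simp only: trihex_corners)?) (simp_all
        add: eisenstein_eq_iff)
    moreover have "face ` {Hex i j, Low i j} \<in> edges (planar_dual trihexagonal_lattice)" for i j
      by (rule edge[of _ _ "2*i+1" "2*j" "2*i" "2*j+1"]; (simp only: trihex_corners)?) (simp_all
        add: eisenstein_eq_iff)
    moreover have "face ` {Hex i j, Up i j} \<in> edges (planar_dual trihexagonal_lattice)" for i j
      by (rule edge[of _ _ "2*i+1" "2*j+2" "2*i+2" "2*j+1"]; (simp only: trihex_corners)?) (simp_all
        add: eisenstein_eq_iff)
    ultimately show "face ` e \<in> edges (planar_dual trihexagonal_lattice)" if "e \<in> E" for e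
      using that unfolding E_def Ev_def Eh_def En_def by blast
    show "card e = 2" if "e \<in> E" for e
      using that unfolding E_def Ev_def Eh_def En_def by auto
    show "finite B" unfolding B_def by simp
    have "Hex 0 0 \<in> B" using assms unfolding B_def by auto
    then show "B \<noteq> {}" by blast
    fix t :: int and x :: "trihex_tile \<Rightarrow> int"
    assume "t \<ge> 0" and x: "\<And>u v. {u, v} \<in> E \<Longrightarrow> u \<in> B \<Longrightarrow> v \<in> B \<Longrightarrow> \<bar>x u - x v\<bar> > t \<longleftrightarrow> {u, v} \<in> F"
    have inB: "Hex i j \<in> B" "Low i j \<in> B" "Up i j \<in> B" if "\<bar>i\<bar> \<le> r + 3" "\<bar>j\<bar> \<le> r + 3" for i j
      using that unfolding B_def by auto
    have far:
      "\<bar>x (Hex (i - 1) j) - x (Low i j)\<bar> > t \<longleftrightarrow> spiral_v i j"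
      "\<bar>x (Up (i - 1) j) - x (Hex i j)\<bar> > t \<longleftrightarrow> spiral_v i j"
      "\<bar>x (Hex i (j - 1)) - x (Low i j)\<bar> > t \<longleftrightarrow> spiral_h i j"
      "\<bar>x (Up i (j - 1)) - x (Hex i j)\<bar> > t \<longleftrightarrow> spiral_h i j"
      "\<not> \<bar>x (Hex i j) - x (Low i j)\<bar> > t" "\<not> \<bar>x (Hex i j) - x (Up i j)\<bar> > t"
      if "\<bar>i\<bar> \<le> r + 2" "\<bar>j\<bar> \<le> r + 2" for i j
    proof -
      have "Hex (i - 1) j \<in> B" "Up (i - 1) j \<in> B" "Hex i (j - 1) \<in> B" "Up i (j - 1) \<in> B"
        "Hex i j \<in> B" "Low i j \<in> B" "Up i j \<in> B"
        by (rule inB; use that in linarith)+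
      moreover have "{Hex (i - 1) j, Low i j} \<in> E" "{Up (i - 1) j, Hex i j} \<in> E"
        "{Hex i (j - 1), Low i j} \<in> E" "{Up i (j - 1), Hex i j} \<in> E"
        "{Hex i j, Low i j} \<in> E" "{Hex i j, Up i j} \<in> E"
        unfolding E_def Ev_def Eh_def En_def by blast+
      ultimately show "\<bar>x (Hex (i - 1) j) - x (Low i j)\<bar> > t \<longleftrightarrow> spiral_v i j"
        "\<bar>x (Up (i - 1) j) - x (Hex i j)\<bar> > t \<longleftrightarrow> spiral_v i j"
        "\<bar>x (Hex i (j - 1)) - x (Low i j)\<bar> > t \<longleftrightarrow> spiral_h i j"
        "\<bar>x (Up i (j - 1)) - x (Hex i j)\<bar> > t \<longleftrightarrow> spiral_h i j"
        "\<not> \<bar>x (Hex i j) - x (Low i j)\<bar> > t" "\<not> \<bar>x (Hex i j) - x (Up i j)\<bar> > t"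
        by (simp_all only: x F not_False_eq_True)
    qed
    \<comment> \<open>Around the grid point \<open>eisenstein (2*i) (2*j)\<close> lie
      \<open>Low i j\<close>, \<open>Hex (i - 1) j\<close>, \<open>Up (i - 1) (j - 1)\<close> and
      \<open>Hex i (j - 1)\<close>.\<close>
    have "\<exists>a b. \<bar>a\<bar> \<le> r + 1 \<and> \<bar>b\<bar> \<le> r + 1 \<and>
        x (Up (0 - 1) (a - 1)) - x (Up (0 - 1) (b - 1)) \<ge> r + 1 - 1"
    proof (rule spiral_spread[where t = t and nw = "\<lambda>i j. x (Hex (i - 1) j)" and ne = "\<lambda>i j. x (Low
      i j)"
          and sw = "\<lambda>i j. x (Up (i - 1) (j - 1))" and se = "\<lambda>i j. x (Hex i (j - 1))"])
      fix i j :: int assume b: "\<bar>i\<bar> \<le> r + 1" "\<bar>j\<bar> \<le> r + 1"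
      then have b': "\<bar>i\<bar> \<le> r + 2" "\<bar>j\<bar> \<le> r + 2" "\<bar>i - 1\<bar> \<le> r + 2" "\<bar>j - 1\<bar> \<le> r + 2" by linarith+
      show "\<bar>x (Hex (i - 1) j) - x (Low i j)\<bar> > t \<longleftrightarrow> spiral_v i j"
        "\<bar>x (Up (i - 1) (j - 1)) - x (Hex i (j - 1))\<bar> > t \<longleftrightarrow> spiral_v i (j - 1)"
        "\<bar>x (Hex i (j - 1)) - x (Low i j)\<bar> > t \<longleftrightarrow> spiral_h i j"
        "\<bar>x (Up (i - 1) (j - 1)) - x (Hex (i - 1) j)\<bar> > t \<longleftrightarrow> spiral_h (i - 1) j"
        by (rule far(1)[OF b'(1,2)] far(2)[OF b'(1,4)] far(3)[OF b'(1,2)] far(4)[OF b'(3,2)])+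
      \<comment> \<open>The 4-cycle around the midpoint of the grid edge:
        \<open>Hex (i - 1) j\<close>, \<open>Low i j\<close>, \<open>Hex i j\<close>,
        \<open>Up (i - 1) j\<close>, with opposite far edges. The horizontal case is
        symmetric.\<close>
      show "x (Hex (i - 1) j) < x (Low i j) \<longleftrightarrow> x (Up (i - 1) (j + 1 - 1)) < x (Hex i (j + 1 - 1))"
        if "spiral_v i j"
        using far(1,2,5)[OF b'(1,2)] far(6)[OF b'(3,2)] that unfolding add_diff_cancel_right' by
          linarith
      show "x (Hex i (j - 1)) < x (Low i j) \<longleftrightarrow> x (Up (i + 1 - 1) (j - 1)) < x (Hex (i + 1 - 1) j)"
        if "spiral_h i j"
        using far(3,4,5)[OF b'(1,2)] far(6)[OF b'(1,4)] that unfolding add_diff_cancel_right' by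
          linarith
    next
      fix j :: int assume "\<bar>j\<bar> \<le> r + 1"
      then have "\<bar>0 - 1\<bar> \<le> r + 2" "\<bar>j - 1\<bar> \<le> r + 2" using assms by linarith+
      then show "\<bar>x (Hex (0 - 1) (j - 1)) - x (Up (0 - 1) (j - 1))\<bar> \<le> t"
        using far(6) not_less by blast
    qed (use assms in simp)
    then obtain a b where "\<bar>a\<bar> \<le> r + 1" "\<bar>b\<bar> \<le> r + 1"
      "x (Up (-1) (a - 1)) - x (Up (-1) (b - 1)) \<ge> r" by auto
    moreover from this have "Up (-1) (a - 1) \<in> B" "Up (-1) (b - 1) \<in> B"
      using assms by (intro inB; linarith)+
    ultimately show "\<exists>u\<in>B. \<exists>v\<in>B. r \<le> x u - x v" by blast
  qed
qed

subsection \<open>The deltoidal trihexagonal tiling\<close>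

definition zeta :: complex ("\<zeta>") where "\<zeta> = cis (pi / 6)"

lemma Re_zeta [simp]: "Re \<zeta> = sqrt 3 / 2" and Im_zeta [simp]: "Im \<zeta> = 1 / 2"
  by (simp_all add: zeta_def cos_30 sin_30)

definition upsilon :: complex ("\<upsilon>") where "\<upsilon> = of_real (1 + sqrt 3) * \<zeta>"

lemma Re_upsilon [simp]: "Re \<upsilon> = (3 + sqrt 3) / 2" and Im_upsilon [simp]: "Im \<upsilon> = (1 + sqrt 3) / 2"
  by (simp_all add: upsilon_def field_simps)

definition hexagon_center :: "int \<Rightarrow> int \<Rightarrow> complex" where
  "hexagon_center a b = \<upsilon> * eisenstein a b"

lemma hexagon_center_diff: "hexagon_center a b - hexagon_center a' b' = hexagon_center (a - a') (b -
  b')"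
  by (simp add: hexagon_center_def eisenstein_diff flip: right_diff_distrib)

lemma hexagon_center_plus: "hexagon_center (a + 1) b = hexagon_center a b + \<upsilon>" "hexagon_center a (b
  + 1) = hexagon_center a b + \<upsilon> * \<omega>"
  by (simp_all add: hexagon_center_def eisenstein_def algebra_simps)

lemma omega_powers: "\<omega> ^ 2 = \<omega> - 1" "\<omega> ^ 3 = -1" "\<omega> ^ 4 = -\<omega>" "\<omega> ^ 5 = 1 - \<omega>"
  by (simp_all add: eval_nat_numeral omega_square algebra_simps)

lemma cis_hexagon: "cis (of_int k * pi / 3) \<in> hexagon_roots"
proof -
  have "of_int k * pi / 3 = 2 * pi * of_int (k div 6) + real (nat (k mod 6)) * (pi / 3)"
  proof -
    have "real_of_int k = 6 * of_int (k div 6) + of_int (k mod 6)"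
      by (metis mult_div_mod_eq of_int_add of_int_mult of_int_numeral)
    then show ?thesis by (simp add: algebra_simps)
  qed
  then have "cis (of_int k * pi / 3) = \<omega> ^ nat (k mod 6)"
    by (simp only: cis_mult[symmetric] omega_def Complex.DeMoivre cis_multiple_2pi Ints_of_int
      mult_1)
  moreover have "k mod 6 = 0 \<or> k mod 6 = 1 \<or> k mod 6 = 2 \<or> k mod 6 = 3 \<or> k mod 6 = 4 \<or> k mod 6 = 5"
    by presburger
  ultimately show ?thesis by (auto simp: hexagon_roots_def omega_powers)
qed

lemma hexagon_root_cis:
  assumes "\<eta> \<in> hexagon_roots"
  shows "\<exists>k::int. \<eta> = cis (of_int k * pi / 3)"
proof -
  have "\<eta> \<in> {\<omega> ^ 0, \<omega> ^ 1, \<omega> ^ 2, \<omega> ^ 3, \<omega> ^ 4, \<omega> ^ 5}"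
    using assms unfolding omega_powers hexagon_roots_def by simp
  then obtain n where "\<eta> = \<omega> ^ n" by blast
  then have "\<eta> = cis (of_int (int n) * pi / 3)" by (simp add: omega_def Complex.DeMoivre
    times_divide_eq_right)
  then show ?thesis by blast
qed

section \<open>The vertices of the rhombitrihexagonal tiling and their distances\<close>

definition rhombitrihex_points :: "complex set" where
  "rhombitrihex_points = {hexagon_center a b + \<eta> | a b \<eta>. \<eta> \<in> hexagon_roots}"

lemma rhombitrihexagonal_eq: "rhombitrihexagonal_lattice = unit_distance_graph rhombitrihex_points"
proof -
  have "{of_real (1 + sqrt 3) * \<zeta> * (of_int a + of_int b * cis (pi / 3)) + cis (of_int k * pi / 3)
      | a b k :: int. True} = rhombitrihex_points"
    unfolding rhombitrihex_points_def hexagon_center_def upsilon_def zeta_def eisenstein_def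
      omega_def
    using cis_hexagon hexagon_root_cis by blast
  then show ?thesis by (simp add: rhombitrihexagonal_lattice_def zeta_def)
qed

text \<open>Since hexagons have width \<open>sqrt 3\<close> in the directions \<open>\<zeta>\<close>, \<open>\<zeta> * \<omega>\<close>, \<open>\<zeta> * (\<omega> - 1)\<close>,
  two distinct hexagons have distance at least 1 in the projection to one of them.\<close>

lemma hexagon_center_far:
  assumes "(m, n) \<noteq> (0, 0)"
  obtains \<kappa> where "\<kappa> \<in> {\<zeta>, \<zeta> * \<omega>, \<zeta> * (\<omega> - 1)}" "1 + sqrt 3 \<le> \<bar>Re (hexagon_center m n * cnj \<kappa>)\<bar>"
proof -
  have "Re (hexagon_center m n * cnj (\<zeta> * \<xi>)) = (1 + sqrt 3) * Re (eisenstein m n * cnj \<xi>)" for \<xi>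
  proof -
    have "hexagon_center m n * cnj (\<zeta> * \<xi>) = of_real (1 + sqrt 3) * (\<zeta> * cnj \<zeta>) * (eisenstein m n *
      cnj \<xi>)"
      by (simp only: hexagon_center_def upsilon_def complex_cnj_mult ac_simps)
    also have "\<zeta> * cnj \<zeta> = 1" by (simp add: zeta_def cis_cnj cis_mult)
    finally have "hexagon_center m n * cnj (\<zeta> * \<xi>) = of_real (1 + sqrt 3) * (eisenstein m n * cnj
      \<xi>)"
      by (simp only: mult_1_right)
    then show ?thesis
      by (simp only: times_complex.sel Re_complex_of_real Im_complex_of_real mult_zero_left
        diff_zero)
  qed
  note proj = this[of 1] this[of \<omega>] this[of "\<omega> - 1"]
  have re: "Re (eisenstein m n * cnj 1) = of_int (2 * m + n) / 2" "Re (eisenstein m n * cnj \<omega>) =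
    of_int (m + 2 * n) / 2"
    "Re (eisenstein m n * cnj (\<omega> - 1)) = of_int (n - m) / 2"
    by (simp_all add: eisenstein_def field_simps)
  have key: "1 + sqrt 3 \<le> \<bar>(1 + sqrt 3) * (of_int k / 2)\<bar>" if "2 \<le> \<bar>k\<bar>" for k :: int
  proof -
    have "1 \<le> \<bar>real_of_int k / 2\<bar>" using that by linarith
    then have "(1 + sqrt 3) * 1 \<le> (1 + sqrt 3) * \<bar>real_of_int k / 2\<bar>"
      by (intro mult_left_mono) auto
    then show ?thesis by (simp add: abs_mult)
  qed
  \<comment> \<open>The third integer is the difference of the first two, whose sum is
    \<open>3 * (m + n)\<close>. If all three were at most 1 in absolute value, the sum would be 0,
    and then all of them would vanish.\<close>
  have "2 \<le> \<bar>2 * m + n\<bar> \<or> 2 \<le> \<bar>m + 2 * n\<bar> \<or> 2 \<le> \<bar>n - m\<bar>"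
    using assms by auto
  then consider "2 \<le> \<bar>2 * m + n\<bar>" | "2 \<le> \<bar>m + 2 * n\<bar>" | "2 \<le> \<bar>n - m\<bar>" by blast
  then show ?thesis
  proof cases
    case 1
    show ?thesis by (rule that[of "\<zeta> * 1"]) (simp, simp only: proj re key[OF 1])
  next
    case 2
    show ?thesis by (rule that[of "\<zeta> * \<omega>"]) (simp, simp only: proj re key[OF 2])
  next
    case 3
    show ?thesis by (rule that[of "\<zeta> * (\<omega> - 1)"]) (simp, simp only: proj re key[OF 3])
  qed
qed

lemma root_projection:
  assumes "\<eta> \<in> hexagon_roots" "\<kappa> \<in> {\<zeta>, \<zeta> * \<omega>, \<zeta> * (\<omega> - 1)}"
  shows "\<bar>Re (\<eta> * cnj \<kappa>)\<bar> \<le> sqrt 3 / 2"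
proof -
  have "\<forall>\<eta>\<in>hexagon_roots. \<forall>\<kappa>\<in>{\<zeta>, \<zeta> * \<omega>, \<zeta> * (\<omega> - 1)}. \<bar>Re (\<eta> * cnj \<kappa>)\<bar> \<le> sqrt 3 / 2"
    unfolding hexagon_roots_def by (simp add: algebra_simps)
  then show ?thesis using assms by blast
qed

lemma norm_direction: "\<kappa> \<in> {\<zeta>, \<zeta> * \<omega>, \<zeta> * (\<omega> - 1)} \<Longrightarrow> norm \<kappa> = 1"
  using norm_hexagon_roots[of "\<omega> - 1"] by (auto simp: norm_mult hexagon_roots_def zeta_def)

text \<open>In the projection the centers are \<open>1 + sqrt 3\<close> apart, and each hexagon
  takes up at most \<open>sqrt 3 / 2\<close> of that. The choice \<open>\<theta> = 0\<close>
  measures the distance to the center of a hexagon, for the emptiness of its circumcircle.\<close>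

lemma hexagon_center_root_norm:
  assumes "(m, n) \<noteq> (0, 0)" "\<eta> \<in> hexagon_roots" "\<theta> \<in> insert 0 hexagon_roots"
  shows "1 \<le> norm (hexagon_center m n + \<eta> - \<theta>)"
proof -
  obtain \<kappa> where \<kappa>: "\<kappa> \<in> {\<zeta>, \<zeta> * \<omega>, \<zeta> * (\<omega> - 1)}" "1 + sqrt 3 \<le> \<bar>Re (hexagon_center m n * cnj \<kappa>)\<bar>"
    using hexagon_center_far[OF assms(1)] by metis
  have "\<bar>Re (\<theta> * cnj \<kappa>)\<bar> \<le> sqrt 3 / 2"
    using assms(3) root_projection[OF _ \<kappa>(1)] by auto
  moreover have "\<bar>Re (\<eta> * cnj \<kappa>)\<bar> \<le> sqrt 3 / 2" using root_projection[OF assms(2) \<kappa>(1)] .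
  moreover have "Re ((hexagon_center m n + \<eta> - \<theta>) * cnj \<kappa>) = Re (hexagon_center m n * cnj \<kappa>) + Re (\<eta>
    * cnj \<kappa>) - Re (\<theta> * cnj \<kappa>)"
    by (simp only: ring_distribs minus_complex.sel plus_complex.sel)
  ultimately have "1 \<le> \<bar>Re ((hexagon_center m n + \<eta> - \<theta>) * cnj \<kappa>)\<bar>" using \<kappa>(2) by linarith
  also have "\<dots> \<le> norm ((hexagon_center m n + \<eta> - \<theta>) * cnj \<kappa>)" by (rule abs_Re_le_cmod)
  also have "\<dots> = norm (hexagon_center m n + \<eta> - \<theta>)" using norm_direction[OF \<kappa>(1)] by (simp only:
    norm_mult complex_mod_cnj mult_1_right)
  finally show ?thesis .
qed

lemma hexagon_root_eisenstein: "\<eta> \<in> hexagon_roots \<Longrightarrow> \<exists>a b. \<eta> = eisenstein a b"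
proof -
  have "hexagon_roots = {eisenstein 1 0, eisenstein 0 1, eisenstein (-1) 1, eisenstein (-1) 0,
    eisenstein 0 (-1), eisenstein 1 (-1)}"
    by (simp add: hexagon_roots_def eisenstein_def)
  then show "\<eta> \<in> hexagon_roots \<Longrightarrow> \<exists>a b. \<eta> = eisenstein a b" by blast
qed

lemma rhombitrihex_points_separated:
  assumes "x \<in> rhombitrihex_points" "y \<in> rhombitrihex_points" "x \<noteq> y"
  shows "1 \<le> dist x y"
proof -
  obtain a b \<eta> where x: "x = hexagon_center a b + \<eta>" "\<eta> \<in> hexagon_roots" using assms(1) by (auto
    simp: rhombitrihex_points_def)
  obtain a' b' \<theta> where y: "y = hexagon_center a' b' + \<theta>" "\<theta> \<in> hexagon_roots" using assms(2) by (auto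
    simp: rhombitrihex_points_def)
  have diff: "x - y = hexagon_center (a - a') (b - b') + \<eta> - \<theta>" using x y hexagon_center_diff[of a b
    a' b'] by (simp add: algebra_simps)
  show ?thesis
  proof (cases "(a - a', b - b') = (0, 0)")
    case True
    then have xy: "x - y = \<eta> - \<theta>" unfolding diff by (simp add: hexagon_center_def eisenstein_def)
    obtain m n m' n' where "\<eta> = eisenstein m n" "\<theta> = eisenstein m' n'" using hexagon_root_eisenstein
      x(2) y(2) by metis
    then have "x - y = eisenstein (m - m') (n - n')" using xy by (simp add: eisenstein_diff)
    moreover have "(m - m', n - n') \<noteq> (0, 0)" using calculation assms(3) by (auto simp:
      eisenstein_def)
    ultimately show ?thesis using norm_eisenstein_ge_1 unfolding dist_norm by metis
  next
    case False
    then show ?thesis using hexagon_center_root_norm[of "a - a'" "b - b'" \<eta> \<theta>] x(2) y(2) unfolding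
      dist_norm diff by simp
  qed
qed

text \<open>\<open>SU a b\<close>, \<open>SV a b\<close> and \<open>SW a b\<close> are the squares between the hexagons \<open>(a, b)\<close> and \<open>(a + 1, b)\<close>,
  \<open>(a, b)\<close> and \<open>(a, b + 1)\<close>, \<open>(a + 1, b)\<close> and \<open>(a, b + 1)\<close>; \<open>TL a b\<close> and \<open>TU a b\<close> are the lower and
  upper triangle in the cell with corners at the hexagons \<open>(a, b)\<close> and \<open>(a + 1, b + 1)\<close>.\<close>

datatype rhombitrihex_tile = Hx int int | SU int int | SV int int | SW int int | TL int int | TU int
  int

primrec rhombitrihex_rot where
  "rhombitrihex_rot (Hx a b) = \<omega>" | "rhombitrihex_rot (SU a b) = \<i>" | "rhombitrihex_rot (SV a b) =
    \<i>" | "rhombitrihex_rot (SW a b) = \<i>"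
| "rhombitrihex_rot (TL a b) = \<omega> - 1" | "rhombitrihex_rot (TU a b) = \<omega> - 1"

primrec rhombitrihex_roots where
  "rhombitrihex_roots (Hx a b) = hexagon_roots"
| "rhombitrihex_roots (SU a b) = square_roots" | "rhombitrihex_roots (SV a b) = square_roots" |
  "rhombitrihex_roots (SW a b) = square_roots"
| "rhombitrihex_roots (TL a b) = triangle_roots" | "rhombitrihex_roots (TU a b) = triangle_roots"

primrec rhombitrihex_ctr where
  "rhombitrihex_ctr (Hx a b) = hexagon_center a b"
| "rhombitrihex_ctr (SU a b) = hexagon_center a b + \<upsilon> / 2"
| "rhombitrihex_ctr (SV a b) = hexagon_center a b + \<omega> * \<upsilon> / 2"
| "rhombitrihex_ctr (SW a b) = hexagon_center (a + 1) b + (\<omega> - 1) * \<upsilon> / 2"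
| "rhombitrihex_ctr (TL a b) = hexagon_center a b + (1 + \<omega>) * \<upsilon> / 3"
| "rhombitrihex_ctr (TU a b) = hexagon_center (a + 1) (b + 1) - (1 + \<omega>) * \<upsilon> / 3"

text \<open>A square is centered midway between two hexagons, a triangle at the centroid of three.
  The radius vector leads to one corner, for instance \<open>hexagon_center a b + 1\<close> for
  \<open>SU a b\<close> and \<open>hexagon_center a b + \<omega>\<close> for
  \<open>TL a b\<close>.\<close>

primrec rhombitrihex_rad where
  "rhombitrihex_rad (Hx a b) = 1"
| "rhombitrihex_rad (SU a b) = 1 - \<upsilon> / 2"
| "rhombitrihex_rad (SV a b) = \<omega> * (1 - \<upsilon> / 2)"
| "rhombitrihex_rad (SW a b) = (\<omega> - 1) * (1 - \<upsilon> / 2)"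
| "rhombitrihex_rad (TL a b) = \<omega> - (1 + \<omega>) * \<upsilon> / 3"
| "rhombitrihex_rad (TU a b) = (1 + \<omega>) * \<upsilon> / 3 - \<omega>"

abbreviation "rhombitrihex_corners u \<equiv> corners (rhombitrihex_roots u) (rhombitrihex_ctr u)
  (rhombitrihex_rad u)"

lemma rhombitrihex_corners:
  "rhombitrihex_corners (Hx a b) = {hexagon_center a b + 1, hexagon_center a b + \<omega>, hexagon_center a
    b + (\<omega> - 1), hexagon_center a b + -1,
     hexagon_center a b + -\<omega>, hexagon_center a b + (1 - \<omega>)}"
  "rhombitrihex_corners (SU a b) = {hexagon_center a b + 1, hexagon_center (a + 1) b + -\<omega>,
    hexagon_center (a + 1) b + -1, hexagon_center a b + \<omega>}"
  "rhombitrihex_corners (SV a b) = {hexagon_center a b + \<omega>, hexagon_center a (b + 1) + (1 - \<omega>),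
    hexagon_center a (b + 1) + -\<omega>, hexagon_center a b + (\<omega> - 1)}"
  "rhombitrihex_corners (SW a b) = {hexagon_center (a + 1) b + (\<omega> - 1), hexagon_center a (b + 1) +
    1, hexagon_center a (b + 1) + (1 - \<omega>), hexagon_center (a + 1) b + -1}"
  "rhombitrihex_corners (TL a b) = {hexagon_center a b + \<omega>, hexagon_center (a + 1) b + -1,
    hexagon_center a (b + 1) + (1 - \<omega>)}"
  "rhombitrihex_corners (TU a b) = {hexagon_center (a + 1) (b + 1) + -\<omega>, hexagon_center a (b + 1) +
    1, hexagon_center (a + 1) b + (\<omega> - 1)}"
proof -
  note unfold = corners_def rhombitrihex_roots.simps rhombitrihex_ctr.simps rhombitrihex_rad.simps
    hexagon_roots_def square_roots_def
    triangle_roots_def image_insert image_empty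
  show "rhombitrihex_corners (Hx a b) = {hexagon_center a b + 1, hexagon_center a b + \<omega>,
    hexagon_center a b + (\<omega> - 1), hexagon_center a b + -1,
     hexagon_center a b + -\<omega>, hexagon_center a b + (1 - \<omega>)}"
    unfolding unfold by (intro arg_cong2[where f = insert] refl; simp)
  show "rhombitrihex_corners (SU a b) = {hexagon_center a b + 1, hexagon_center (a + 1) b + -\<omega>,
    hexagon_center (a + 1) b + -1, hexagon_center a b + \<omega>}"
    unfolding unfold hexagon_center_plus
    by (intro arg_cong2[where f = insert] refl; simp add: complex_eq_iff field_simps)
  show "rhombitrihex_corners (SV a b) = {hexagon_center a b + \<omega>, hexagon_center a (b + 1) + (1 - \<omega>),
    hexagon_center a (b + 1) + -\<omega>, hexagon_center a b + (\<omega> - 1)}"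
    unfolding unfold hexagon_center_plus
    by (intro arg_cong2[where f = insert] refl; simp add: complex_eq_iff field_simps)
  show "rhombitrihex_corners (SW a b) = {hexagon_center (a + 1) b + (\<omega> - 1), hexagon_center a (b +
    1) + 1, hexagon_center a (b + 1) + (1 - \<omega>), hexagon_center (a + 1) b + -1}"
    unfolding unfold hexagon_center_plus
    by (intro arg_cong2[where f = insert] refl; simp add: complex_eq_iff field_simps)
  show "rhombitrihex_corners (TL a b) = {hexagon_center a b + \<omega>, hexagon_center (a + 1) b + -1,
    hexagon_center a (b + 1) + (1 - \<omega>)}"
    unfolding unfold hexagon_center_plus
    by (intro arg_cong2[where f = insert] refl; simp add: complex_eq_iff field_simps)
  show "rhombitrihex_corners (TU a b) = {hexagon_center (a + 1) (b + 1) + -\<omega>, hexagon_center a (b +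
    1) + 1, hexagon_center (a + 1) b + (\<omega> - 1)}"
    unfolding unfold hexagon_center_plus
    by (intro arg_cong2[where f = insert] refl; simp add: complex_eq_iff field_simps)
qed

lemma rhombitrihex_rad_norm:
  "(norm (rhombitrihex_rad (SU a b)))\<^sup>2 = 1 / 2" "(norm (rhombitrihex_rad (SV a b)))\<^sup>2 = 1 / 2"
    "(norm (rhombitrihex_rad (SW a b)))\<^sup>2 = 1 / 2"
  "(norm (rhombitrihex_rad (TL a b)))\<^sup>2 = 1 / 3" "(norm (rhombitrihex_rad (TU a b)))\<^sup>2 = 1 / 3"
proof -
  have s: "(norm (1 - \<upsilon> / 2))\<^sup>2 = 1 / 2"
    unfolding cmod_power2 by (simp add: power2_eq_square field_simps)
  have "norm (\<omega> - 1) = 1" by (rule norm_hexagon_roots) (simp add: hexagon_roots_def)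
  with s show "(norm (rhombitrihex_rad (SU a b)))\<^sup>2 = 1 / 2" "(norm (rhombitrihex_rad (SV a b)))\<^sup>2 =
    1 / 2" "(norm (rhombitrihex_rad (SW a b)))\<^sup>2 = 1 / 2"
    by (simp_all only: rhombitrihex_rad.simps norm_mult norm_omega mult_1)
  show t: "(norm (rhombitrihex_rad (TL a b)))\<^sup>2 = 1 / 3"
    unfolding rhombitrihex_rad.simps cmod_power2 by (simp add: power2_eq_square field_simps)
  show "(norm (rhombitrihex_rad (TU a b)))\<^sup>2 = 1 / 3"
    using t unfolding rhombitrihex_rad.simps by (simp only: norm_minus_commute)
qed

lemma in_rhombitrihex_points: "\<eta> \<in> hexagon_roots \<Longrightarrow> hexagon_center a b + \<eta> \<in> rhombitrihex_points"
  unfolding rhombitrihex_points_def by blast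

lemma rhombitrihex_polygon: "unit_polygon (rhombitrihex_rot u) (rhombitrihex_roots u)
  (rhombitrihex_rad u)"
  by (cases u; simp only: rhombitrihex_rot.simps rhombitrihex_roots.simps)
    (intro unit_polygon_hexagon unit_polygon_square unit_polygon_triangle rhombitrihex_rad_norm;
      simp)+

lemma rhombitrihex_tiling: "unit_tiling rhombitrihex_points rhombitrihex_rot rhombitrihex_ctr
  rhombitrihex_rad rhombitrihex_roots"
proof (rule unit_tiling.intro)
  have cV: "rhombitrihex_corners u \<subseteq> rhombitrihex_points" for u
    by (cases u; simp only: rhombitrihex_corners insert_subset empty_subsetI simp_thms)
      (intro conjI in_rhombitrihex_points; simp add: hexagon_roots_def)+
  show "unit_tile (rhombitrihex_rot u) (rhombitrihex_roots u) (rhombitrihex_ctr u) (rhombitrihex_rad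
    u) rhombitrihex_points" for u
  proof -
    interpret unit_polygon "rhombitrihex_rot u" "rhombitrihex_roots u" "rhombitrihex_ctr u"
      "rhombitrihex_rad u" by (rule rhombitrihex_polygon)
    have "norm (rhombitrihex_rad u) \<le> dist x (rhombitrihex_ctr u)" if x: "x \<in> rhombitrihex_points"
      for x
    proof (cases "\<exists>a b. u = Hx a b")
      case True
      then obtain a b where u: "u = Hx a b" by blast
      obtain a' b' \<eta> where \<eta>: "x = hexagon_center a' b' + \<eta>" "\<eta> \<in> hexagon_roots" using x by (auto
        simp: rhombitrihex_points_def)
      have d: "x - hexagon_center a b = hexagon_center (a' - a) (b' - b) + \<eta>"
        using \<eta>(1) hexagon_center_diff[of a' b' a b] by (simp add: algebra_simps)
      have "1 \<le> norm (x - hexagon_center a b)"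
      proof (cases "(a' - a, b' - b) = (0, 0)")
        case True
        then show ?thesis unfolding d using norm_hexagon_roots[OF \<eta>(2)] by (simp add:
          hexagon_center_def eisenstein_def)
      next
        case False
        then show ?thesis unfolding d using hexagon_center_root_norm[of "a' - a" "b' - b" \<eta> 0] \<eta>(2)
          by simp
      qed
      then show ?thesis by (simp add: u dist_norm)
    next
      case False
      then have "(norm (rhombitrihex_rad u))\<^sup>2 \<in> {1 / 2, 1 / 3}"
        using rhombitrihex_rad_norm by (cases u) (simp_all del: rhombitrihex_rad.simps)
      then have "(norm (rhombitrihex_rad u))\<^sup>2 \<le> 1 / 2" by auto
      then show ?thesis using small_circle_empty[OF rhombitrihex_points_separated cV _ x] by blast
    qed
    then show ?thesis by unfold_locales (use rhombitrihex_points_separated cV in auto)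
  qed
  \<comment> \<open>The denominators 2 and 3 are cleared; the pairs of residues modulo 6 are
    different for the six kinds of tiles.\<close>
  have 6: "6 * rhombitrihex_ctr u = \<upsilon> * (case u of Hx a b \<Rightarrow> eisenstein (6*a) (6*b) | SU a b \<Rightarrow>
    eisenstein (6*a+3) (6*b)
      | SV a b \<Rightarrow> eisenstein (6*a) (6*b+3) | SW a b \<Rightarrow> eisenstein (6*a+3) (6*b+3)
      | TL a b \<Rightarrow> eisenstein (6*a+2) (6*b+2) | TU a b \<Rightarrow> eisenstein (6*a+4) (6*b+4))" for u
    by (cases u) (simp_all add: hexagon_center_def eisenstein_def field_simps)
  have "\<upsilon> \<noteq> 0" by (simp add: complex_eq_iff)
  show "inj rhombitrihex_ctr"
  proof (rule injI)
    fix u v assume "rhombitrihex_ctr u = rhombitrihex_ctr v"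
    then have "6 * rhombitrihex_ctr u = 6 * rhombitrihex_ctr v" by simp
    then show "u = v"
      unfolding 6 mult_cancel_left using \<open>\<upsilon> \<noteq> 0\<close>
      by (cases u; cases v; simp add: eisenstein_eq_iff; presburger)
  qed
qed

lemma rhombitrihexagonal_dual_obstruction:
  fixes r :: int
  assumes "r > 0"
  shows "\<exists>H. finite_subgraph H (planar_dual rhombitrihexagonal_lattice) \<and>
    (\<forall>t\<ge>0. \<not> total_threshold_colorable r t H)"
proof -
  interpret unit_tiling rhombitrihex_points rhombitrihex_rot rhombitrihex_ctr rhombitrihex_rad
    rhombitrihex_roots by (rule rhombitrihex_tiling)
  \<comment> \<open>The grid lines from the corner of \<open>Hx i j\<close>, \<open>SU i j\<close>, \<open>TL i j\<close>, \<open>SV i j\<close> to the next such corner run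
    along three lattice edges each; \<open>Ev\<close> and \<open>Eh\<close> are the dual edges crossing them.\<close>
  define Ev where "Ev i j = {{SV i j, TL i j}, {Hx i (j + 1), SW i j}, {Hx i (j + 1), SU i (j +
    1)}}" for i j
  define Eh where "Eh i j = {{SU i j, TL i j}, {Hx (i + 1) j, SW i j}, {Hx (i + 1) j, SV (i + 1)
    j}}" for i j
  define En where "En i j = {{TL i j, SW i j}, {Hx i (j + 1), SV i j}, {SW i j, TU i j}, {TU i j, SU
    i (j + 1)}, {Hx (i + 1) j, SU i j}, {TU i j, SV (i + 1) j}}" for i j
  define E where "E = (\<Union>i j. Ev i j \<union> Eh i j \<union> En i j)"
  define F where "F = (\<Union>i j. (if spiral_v i j then Ev i j else {}) \<union> (if spiral_h i j then Eh i j
    else {}))"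
  define B where "B = (\<Union>i\<in>{-r - 3..r + 3}. \<Union>j\<in>{-r - 3..r + 3}. {Hx i j, SU i j, SV i j, SW i j, TL i
    j, TU i j})"
  have F: "{SV i j, TL i j} \<in> F \<longleftrightarrow> spiral_v i j" "{Hx i (j + 1), SW i j} \<in> F \<longleftrightarrow> spiral_v i j" "{Hx i
    (j + 1), SU i (j + 1)} \<in> F \<longleftrightarrow> spiral_v i j"
    "{SU i j, TL i j} \<in> F \<longleftrightarrow> spiral_h i j" "{Hx (i + 1) j, SW i j} \<in> F \<longleftrightarrow> spiral_h i j" "{Hx (i + 1)
      j, SV (i + 1) j} \<in> F \<longleftrightarrow> spiral_h i j"
    "{TL i j, SW i j} \<notin> F" "{Hx i (j + 1), SV i j} \<notin> F" "{SW i j, TU i j} \<notin> F" "{TU i j, SU i (j +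
      1)} \<notin> F" "{Hx (i + 1) j, SU i j} \<notin> F" "{TU i j, SV (i + 1) j} \<notin> F" for i j
    unfolding F_def Ev_def Eh_def by (auto simp: doubleton_eq_iff split: if_splits)
  have edge: "face ` {u, v} \<in> edges (planar_dual rhombitrihexagonal_lattice)"
    if "u \<noteq> v" "{p, q} \<subseteq> rhombitrihex_corners u \<inter> rhombitrihex_corners v" "dist p q = 1" for u v p q
    unfolding rhombitrihexagonal_eq using that by (rule face_edge)
  show ?thesis
  proof (rule not_colorable_subgraph[where \<phi> = face and E = E and B = B and F = F])
    show "inj face" by (rule inj_face)
    show "face u \<in> verts (planar_dual rhombitrihexagonal_lattice)" for u
      unfolding rhombitrihexagonal_eq by (rule face_in_verts)
    have "face ` {SV i j, TL i j} \<in> edges (planar_dual rhombitrihexagonal_lattice)" for i j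
      by (rule edge[of _ _ "hexagon_center i j + \<omega>" "hexagon_center i (j + 1) + (1 - \<omega>)"]; (simp
        only: rhombitrihex_corners hexagon_center_plus)?) (simp_all add: dist_norm cmod_def
        power2_eq_square field_simps)
    moreover have "face ` {Hx i (j + 1), SW i j} \<in> edges (planar_dual rhombitrihexagonal_lattice)"
      for i j
      by (rule edge[of _ _ "hexagon_center i (j + 1) + (1 - \<omega>)" "hexagon_center i (j + 1) + 1"];
        (simp only: rhombitrihex_corners hexagon_center_plus)?) (simp_all add: dist_norm cmod_def
        power2_eq_square field_simps)
    moreover have "face ` {Hx i (j + 1), SU i (j + 1)} \<in> edges (planar_dual
      rhombitrihexagonal_lattice)" for i j
      by (rule edge[of _ _ "hexagon_center i (j + 1) + 1" "hexagon_center i (j + 1) + \<omega>"]; (simp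
        only: rhombitrihex_corners hexagon_center_plus)?) (simp_all add: dist_norm cmod_def
        power2_eq_square field_simps)
    moreover have "face ` {SU i j, TL i j} \<in> edges (planar_dual rhombitrihexagonal_lattice)" for i j
      by (rule edge[of _ _ "hexagon_center i j + \<omega>" "hexagon_center (i + 1) j + -1"]; (simp only:
        rhombitrihex_corners hexagon_center_plus)?) (simp_all add: dist_norm cmod_def
        power2_eq_square field_simps)
    moreover have "face ` {Hx (i + 1) j, SW i j} \<in> edges (planar_dual rhombitrihexagonal_lattice)"
      for i j
      by (rule edge[of _ _ "hexagon_center (i + 1) j + (\<omega> - 1)" "hexagon_center (i + 1) j + -1"];
        (simp only: rhombitrihex_corners hexagon_center_plus)?) (simp_all add: dist_norm cmod_def
        power2_eq_square field_simps)
    moreover have "face ` {Hx (i + 1) j, SV (i + 1) j} \<in> edges (planar_dual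
      rhombitrihexagonal_lattice)" for i j
      by (rule edge[of _ _ "hexagon_center (i + 1) j + \<omega>" "hexagon_center (i + 1) j + (\<omega> - 1)"];
        (simp only: rhombitrihex_corners hexagon_center_plus)?) (simp_all add: dist_norm cmod_def
        power2_eq_square field_simps)
    moreover have "face ` {TL i j, SW i j} \<in> edges (planar_dual rhombitrihexagonal_lattice)" for i j
      by (rule edge[of _ _ "hexagon_center (i + 1) j + -1" "hexagon_center i (j + 1) + (1 - \<omega>)"];
        (simp only: rhombitrihex_corners hexagon_center_plus)?) (simp_all add: dist_norm cmod_def
        power2_eq_square field_simps)
    moreover have "face ` {Hx i (j + 1), SV i j} \<in> edges (planar_dual rhombitrihexagonal_lattice)"
      for i j
      by (rule edge[of _ _ "hexagon_center i (j + 1) + -\<omega>" "hexagon_center i (j + 1) + (1 - \<omega>)"];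
        (simp only: rhombitrihex_corners hexagon_center_plus)?) (simp_all add: dist_norm cmod_def
        power2_eq_square field_simps)
    moreover have "face ` {SW i j, TU i j} \<in> edges (planar_dual rhombitrihexagonal_lattice)" for i j
      by (rule edge[of _ _ "hexagon_center (i + 1) j + (\<omega> - 1)" "hexagon_center i (j + 1) + 1"];
        (simp only: rhombitrihex_corners hexagon_center_plus)?) (simp_all add: dist_norm cmod_def
        power2_eq_square field_simps)
    moreover have "face ` {TU i j, SU i (j + 1)} \<in> edges (planar_dual rhombitrihexagonal_lattice)"
      for i j
      by (rule edge[of _ _ "hexagon_center i (j + 1) + 1" "hexagon_center (i + 1) (j + 1) + -\<omega>"];
        (simp only: rhombitrihex_corners hexagon_center_plus)?) (simp_all add: dist_norm cmod_def
        power2_eq_square field_simps)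
    moreover have "face ` {Hx (i + 1) j, SU i j} \<in> edges (planar_dual rhombitrihexagonal_lattice)"
      for i j
      by (rule edge[of _ _ "hexagon_center (i + 1) j + -1" "hexagon_center (i + 1) j + -\<omega>"]; (simp
        only: rhombitrihex_corners hexagon_center_plus)?) (simp_all add: dist_norm cmod_def
        power2_eq_square field_simps)
    moreover have "face ` {TU i j, SV (i + 1) j} \<in> edges (planar_dual rhombitrihexagonal_lattice)"
      for i j
      by (rule edge[of _ _ "hexagon_center (i + 1) j + (\<omega> - 1)" "hexagon_center (i + 1) (j + 1) +
        -\<omega>"]; (simp only: rhombitrihex_corners hexagon_center_plus)?) (simp_all add: dist_norm
        cmod_def power2_eq_square field_simps)
    ultimately have "\<forall>i j. \<forall>e\<in>Ev i j \<union> Eh i j \<union> En i j. face ` e \<in> edges (planar_dual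
      rhombitrihexagonal_lattice)"
      unfolding Ev_def Eh_def En_def by simp
    then show "face ` e \<in> edges (planar_dual rhombitrihexagonal_lattice)" if "e \<in> E" for e
      using that unfolding E_def by blast
    show "card e = 2" if "e \<in> E" for e
      using that unfolding E_def Ev_def Eh_def En_def by auto
    show "finite B" unfolding B_def by simp
    have "Hx 0 0 \<in> B" using assms unfolding B_def by auto
    then show "B \<noteq> {}" by blast
    fix t :: int and x :: "rhombitrihex_tile \<Rightarrow> int"
    assume "t \<ge> 0" and x: "\<And>u v. {u, v} \<in> E \<Longrightarrow> u \<in> B \<Longrightarrow> v \<in> B \<Longrightarrow> \<bar>x u - x v\<bar> > t \<longleftrightarrow> {u, v} \<in> F"
    have inB: "Hx i j \<in> B" "SU i j \<in> B" "SV i j \<in> B" "SW i j \<in> B" "TL i j \<in> B" "TU i j \<in> B"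
      if "\<bar>i\<bar> \<le> r + 3" "\<bar>j\<bar> \<le> r + 3" for i j
      using that unfolding B_def by auto
    have inE: "e \<in> E" if "e \<in> Ev i j \<union> Eh i j \<union> En i j" for e i j
      using that unfolding E_def by blast
    have far:
      "\<bar>x (SV i j) - x (TL i j)\<bar> > t \<longleftrightarrow> spiral_v i j"
      "\<bar>x (Hx i (j + 1)) - x (SW i j)\<bar> > t \<longleftrightarrow> spiral_v i j"
      "\<bar>x (Hx i (j + 1)) - x (SU i (j + 1))\<bar> > t \<longleftrightarrow> spiral_v i j"
      "\<bar>x (SU i j) - x (TL i j)\<bar> > t \<longleftrightarrow> spiral_h i j"
      "\<bar>x (Hx (i + 1) j) - x (SW i j)\<bar> > t \<longleftrightarrow> spiral_h i j"
      "\<bar>x (Hx (i + 1) j) - x (SV (i + 1) j)\<bar> > t \<longleftrightarrow> spiral_h i j"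
      "\<not> \<bar>x (TL i j) - x (SW i j)\<bar> > t"
      "\<not> \<bar>x (Hx i (j + 1)) - x (SV i j)\<bar> > t"
      "\<not> \<bar>x (SW i j) - x (TU i j)\<bar> > t"
      "\<not> \<bar>x (TU i j) - x (SU i (j + 1))\<bar> > t"
      "\<not> \<bar>x (Hx (i + 1) j) - x (SU i j)\<bar> > t"
      "\<not> \<bar>x (TU i j) - x (SV (i + 1) j)\<bar> > t"
      if "\<bar>i\<bar> \<le> r + 2" "\<bar>j\<bar> \<le> r + 2" for i j
    proof -
      have "Hx (i + 1) j \<in> B" "Hx i (j + 1) \<in> B" "SU i (j + 1) \<in> B" "SU i j \<in> B" "SV (i + 1) j \<in> B"
        "SV i j \<in> B" "SW i j \<in> B" "TL i j \<in> B" "TU i j \<in> B"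
        by (rule inB; use that in linarith)+
      moreover have "{SV i j, TL i j} \<in> E" "{Hx i (j + 1), SW i j} \<in> E" "{Hx i (j + 1), SU i (j +
        1)} \<in> E" "{SU i j, TL i j} \<in> E" "{Hx (i + 1) j, SW i j} \<in> E" "{Hx (i + 1) j, SV (i + 1) j} \<in>
        E" "{TL i j, SW i j} \<in> E" "{Hx i (j + 1), SV i j} \<in> E" "{SW i j, TU i j} \<in> E" "{TU i j, SU i
        (j + 1)} \<in> E" "{Hx (i + 1) j, SU i j} \<in> E" "{TU i j, SV (i + 1) j} \<in> E"
        by (rule inE[of _ i j]; simp add: Ev_def Eh_def En_def)+
      ultimately show
        "\<bar>x (SV i j) - x (TL i j)\<bar> > t \<longleftrightarrow> spiral_v i j"
      "\<bar>x (Hx i (j + 1)) - x (SW i j)\<bar> > t \<longleftrightarrow> spiral_v i j"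
      "\<bar>x (Hx i (j + 1)) - x (SU i (j + 1))\<bar> > t \<longleftrightarrow> spiral_v i j"
      "\<bar>x (SU i j) - x (TL i j)\<bar> > t \<longleftrightarrow> spiral_h i j"
      "\<bar>x (Hx (i + 1) j) - x (SW i j)\<bar> > t \<longleftrightarrow> spiral_h i j"
      "\<bar>x (Hx (i + 1) j) - x (SV (i + 1) j)\<bar> > t \<longleftrightarrow> spiral_h i j"
      "\<not> \<bar>x (TL i j) - x (SW i j)\<bar> > t"
      "\<not> \<bar>x (Hx i (j + 1)) - x (SV i j)\<bar> > t"
      "\<not> \<bar>x (SW i j) - x (TU i j)\<bar> > t"
      "\<not> \<bar>x (TU i j) - x (SU i (j + 1))\<bar> > t"
      "\<not> \<bar>x (Hx (i + 1) j) - x (SU i j)\<bar> > t"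
      "\<not> \<bar>x (TU i j) - x (SV (i + 1) j)\<bar> > t"
        by (simp_all only: x F not_False_eq_True)
    qed
    have "\<exists>a b. \<bar>a\<bar> \<le> r + 1 \<and> \<bar>b\<bar> \<le> r + 1 \<and> x (Hx 0 a) - x (Hx 0 b) \<ge> r + 1 - 1"
    proof (rule spiral_spread[where t = t and nw = "\<lambda>i j. x (SV i j)" and ne = "\<lambda>i j. x (TL i j)"
          and sw = "\<lambda>i j. x (Hx i j)" and se = "\<lambda>i j. x (SU i j)"])
      fix i j :: int assume b: "\<bar>i\<bar> \<le> r + 1" "\<bar>j\<bar> \<le> r + 1"
      then have b': "\<bar>i\<bar> \<le> r + 2" "\<bar>j\<bar> \<le> r + 2" "\<bar>i - 1\<bar> \<le> r + 2" "\<bar>j - 1\<bar> \<le> r + 2" by linarith+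
      show "\<bar>x (SV i j) - x (TL i j)\<bar> > t \<longleftrightarrow> spiral_v i j"
        "\<bar>x (SU i j) - x (TL i j)\<bar> > t \<longleftrightarrow> spiral_h i j"
        by (rule far(1)[OF b'(1,2)] far(4)[OF b'(1,2)])+
      show "\<bar>x (Hx i j) - x (SU i j)\<bar> > t \<longleftrightarrow> spiral_v i (j - 1)"
        "\<bar>x (Hx i j) - x (SV i j)\<bar> > t \<longleftrightarrow> spiral_h (i - 1) j"
        using far(3)[OF b'(1,4)] far(6)[OF b'(3,2)] unfolding diff_add_cancel .
      \<comment> \<open>The two inner vertices of the subdivided grid edge. Around the first, the
        far edges are opposite; around the second, both end at \<open>Hx i (j + 1)\<close>, which is
        therefore higher or lower than both neighbors. The horizontal case is symmetric.\<close>
      show "x (SV i j) < x (TL i j) \<longleftrightarrow> x (Hx i (j + 1)) < x (SU i (j + 1))" if "spiral_v i j"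
      proof -
        have "x (SV i j) < x (TL i j) \<longleftrightarrow> x (Hx i (j + 1)) < x (SW i j)"
          using far(1,2,7,8)[OF b'(1,2)] that by linarith
        also have "\<dots> \<longleftrightarrow> x (Hx i (j + 1)) < x (SU i (j + 1))"
          using far(2,3,9,10)[OF b'(1,2)] that by linarith
        finally show ?thesis .
      qed
      show "x (SU i j) < x (TL i j) \<longleftrightarrow> x (Hx (i + 1) j) < x (SV (i + 1) j)" if "spiral_h i j"
      proof -
        have "x (SU i j) < x (TL i j) \<longleftrightarrow> x (Hx (i + 1) j) < x (SW i j)"
          using far(4,5,7,11)[OF b'(1,2)] that by linarith
        also have "\<dots> \<longleftrightarrow> x (Hx (i + 1) j) < x (SV (i + 1) j)"
          using far(5,6,9,12)[OF b'(1,2)] that by linarith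
        finally show ?thesis .
      qed
    next
      fix j :: int assume "\<bar>j\<bar> \<le> r + 1"
      then have "\<bar>0\<bar> \<le> r + 2" "\<bar>j - 1\<bar> \<le> r + 2" using assms by linarith+
      from far(8)[OF this] show "\<bar>x (SV 0 (j - 1)) - x (Hx 0 j)\<bar> \<le> t"
        by (simp add: abs_minus_commute)
    qed (use assms in simp)
    then obtain a b where "\<bar>a\<bar> \<le> r + 1" "\<bar>b\<bar> \<le> r + 1" "x (Hx 0 a) - x (Hx 0 b) \<ge> r" by auto
    moreover from this have "Hx 0 a \<in> B" "Hx 0 b \<in> B"
      using assms by (intro inB; linarith)+
    ultimately show "\<exists>u\<in>B. \<exists>v\<in>B. r \<le> x u - x v" by blast
  qed
qed

theorem mainTheorem9:
  fixes r :: int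
  assumes "r > 0"
  shows "(\<exists>H. finite_subgraph H square_lattice \<and>
            (\<forall>t\<ge>0. \<not> total_threshold_colorable r t H)) \<and>
         (\<exists>H. finite_subgraph H (planar_dual rhombitrihexagonal_lattice) \<and>
            (\<forall>t\<ge>0. \<not> total_threshold_colorable r t H)) \<and>
         (\<exists>H. finite_subgraph H (planar_dual trihexagonal_lattice) \<and>
            (\<forall>t\<ge>0. \<not> total_threshold_colorable r t H))"
  using square_lattice_obstruction[OF assms] rhombitrihexagonal_dual_obstruction[OF assms]
    trihexagonal_dual_obstruction[OF assms] by blast

end
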